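(* Let $G=(\mathcal V,\mathcal E)$ be a locally finite, connected, simple graph with a Markov kernel $K$, let $\Gamma_K$ be a subgroup of $\mathrm{Aut}_K(G)$, and suppose $(G,K,\Gamma_K)$ is transitive, unimodular, and infinitely accessible. Let $\mathbf 0\in\mathcal V$ be a fixed vertex, and consider the parking process on $(G,K)$ with car density $p\in[0,1]$. Then, whenever the conditioning event has positive probability (i.e. $p>0$ in the first formula and $p<1$ in the second), $$\mathbf P[\text{the car initially at }\mathbf 0\text{ eventually parks}\mid \mathbf 0\text{ has a car initially}]=\begin{cases}\frac{1-p}{p}, & p>1/2,\\ 1,& p\le 1/2,\end{cases}$$ $$\mathbf P[\text{some car eventually parks in the spot at }\mathbf 0\mid \mathbf 0\text{ is a parking spot}]=\begin{cases}1,& p\ge 1/2,\\ \frac{p}{1-p},& p<1/2.\end{cases}$$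
   Context: A (Markov) kernel on $G$ is a function $K:\mathcal V\times\mathcal V\to[0,1]$ with $K(u,v)=0$ if $(u,v)\notin\mathcal E$ and $\sum_{v\in N(u)}K(u,v)=1$, where $N(u)$ is the set of neighbors of $u$. A vertex $u$ is accessible from $v$ if there are adjacent vertices $v=x_0,x_1,\dots,x_n=u$ with $\prod_{i=0}^{n-1}K(x_i,x_{i+1})>0$. $\mathrm{Aut}_K(G)$ is the group of graph automorphisms $\varphi$ of $G$ with $K(\varphi(u),\varphi(v))=K(u,v)$ for all $u,v\in\mathcal V$. For a subgroup $\Gamma_K\le\mathrm{Aut}_K(G)$ put $\Gamma_K(u,v)=\{\varphi\in\Gamma_K:\varphi(u)=v\}$. The triple $(G,K,\Gamma_K)$ is: transitive if $\Gamma_K(u,v)\ne\emptyset$ for all $u,v\in\mathcal V$; unimodular if $|\Gamma_K(u,u)v|=|\Gamma_K(v,v)u|<\infty$ for all $u,v\in\mathcal V$ (where $\Gamma_K(u,u)v$ is the orbit of $v$ under the stabilizer of $u$); infinitely accessible if there exist $\varphi\in\Gamma_K$ and $u\in\mathcal V$ such that $\{\varphi^n(u):n\ge0\}$ is infinite and $u$ is accessible from $\varphi(u)$. Parking process on $(G,K)$ with density $p$: initially each vertex independently contains one car with probability $p$, and otherwise is a parking spot that fits one car. In discrete time, all unparked cars simultaneously perform independent random walks with transition kernel $K$. When one or more unparked cars move at the same time to a still unoccupied parking spot, exactly one of them parks there forever (each car has i.i.d. uniform $[0,1]$ tie-breaking variables, independent of everything else, one per time step, and the car with the smallest value parks); the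 others remain unparked and keep walking. Cars arriving at an occupied spot or at a vertex that initially contained a car pass through unaffected. *)

theory Defs
  imports "HOL-Probability.Probability" "HOL-Algebra.Bij"
begin

text \<open>
  A graph is given by its adjacency relation; its vertex set is the whole type \<open>'v\<close>.
\<close>

definition simple_graph :: "('v \<Rightarrow> 'v \<Rightarrow> bool) \<Rightarrow> bool" where
  "simple_graph E \<longleftrightarrow> symp E \<and> irreflp E"

definition nbhd :: "('v \<Rightarrow> 'v \<Rightarrow> bool) \<Rightarrow> 'v \<Rightarrow> 'v set" where
  "nbhd E u = {v. E u v}"

definition locally_finite_graph :: "('v \<Rightarrow> 'v \<Rightarrow> bool) \<Rightarrow> bool" where
  "locally_finite_graph E \<longleftrightarrow> (\<forall>u. finite (nbhd E u))"

definition connected_graph :: "('v \<Rightarrow> 'v \<Rightarrow> bool) \<Rightarrow> bool" where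
  "connected_graph E \<longleftrightarrow> (\<forall>u v. E\<^sup>*\<^sup>* u v)"

definition markov_kernel :: "('v \<Rightarrow> 'v \<Rightarrow> bool) \<Rightarrow> ('v \<Rightarrow> 'v \<Rightarrow> real) \<Rightarrow> bool" where
  "markov_kernel E K \<longleftrightarrow>
     (\<forall>u v. 0 \<le> K u v \<and> K u v \<le> 1) \<and>
     (\<forall>u v. \<not> E u v \<longrightarrow> K u v = 0) \<and>
     (\<forall>u. (\<Sum>v\<in>nbhd E u. K u v) = 1)"

text \<open>\<open>accessible_from E K u v\<close>: the vertex \<open>u\<close> is accessible from \<open>v\<close>.\<close>

definition accessible_from ::
  "('v \<Rightarrow> 'v \<Rightarrow> bool) \<Rightarrow> ('v \<Rightarrow> 'v \<Rightarrow> real) \<Rightarrow> 'v \<Rightarrow> 'v \<Rightarrow> bool" where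
  "accessible_from E K u v \<longleftrightarrow>
     (\<exists>n (x :: nat \<Rightarrow> 'v). x 0 = v \<and> x n = u \<and>
        (\<forall>i<n. E (x i) (x (Suc i))) \<and> (\<Prod>i<n. K (x i) (x (Suc i))) > 0)"

definition kernel_aut ::
  "('v \<Rightarrow> 'v \<Rightarrow> bool) \<Rightarrow> ('v \<Rightarrow> 'v \<Rightarrow> real) \<Rightarrow> ('v \<Rightarrow> 'v) set" where
  "kernel_aut E K =
     {\<phi>. bij \<phi> \<and> (\<forall>u v. E (\<phi> u) (\<phi> v) \<longleftrightarrow> E u v) \<and> (\<forall>u v. K (\<phi> u) (\<phi> v) = K u v)}"

definition Aut_K ::
  "('v \<Rightarrow> 'v \<Rightarrow> bool) \<Rightarrow> ('v \<Rightarrow> 'v \<Rightarrow> real) \<Rightarrow> ('v \<Rightarrow> 'v) monoid" where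
  "Aut_K E K = (BijGroup UNIV)\<lparr>carrier := kernel_aut E K\<rparr>"

lemma carrier_BijGroup_UNIV: "carrier (BijGroup UNIV) = {\<phi>. bij \<phi>}"
  by (auto simp: BijGroup_def Bij_def)

lemma mult_BijGroup_UNIV:
  "bij \<phi> \<Longrightarrow> bij \<psi> \<Longrightarrow> \<phi> \<otimes>\<^bsub>BijGroup UNIV\<^esub> \<psi> = \<phi> \<circ> \<psi>"
  by (auto simp: BijGroup_def Bij_def compose_def fun_eq_iff)

lemma inv_BijGroup_UNIV: "bij \<phi> \<Longrightarrow> inv\<^bsub>BijGroup UNIV\<^esub> \<phi> = inv_into UNIV \<phi>"
  by (subst inv_BijGroup) (auto simp: Bij_def)

lemma subgroup_kernel_aut: "subgroup (kernel_aut E K) (BijGroup UNIV)"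
proof (rule group.subgroupI[OF group_BijGroup])
  show "kernel_aut E K \<subseteq> carrier (BijGroup UNIV)"
    by (auto simp: carrier_BijGroup_UNIV kernel_aut_def)
  have "id \<in> kernel_aut E K"
    by (simp add: kernel_aut_def)
  then show "kernel_aut E K \<noteq> {}"
    by blast
next
  fix \<phi> assume \<phi>: "\<phi> \<in> kernel_aut E K"
  then have b: "bij \<phi>"
    by (simp add: kernel_aut_def)
  then have s: "\<phi> (inv_into UNIV \<phi> x) = x" for x
    by (simp add: bij_is_surj surj_f_inv_f)
  have "inv_into UNIV \<phi> \<in> kernel_aut E K"
    using \<phi> b s by (auto simp: kernel_aut_def bij_imp_bij_inv) (metis s)+
  then show "inv\<^bsub>BijGroup UNIV\<^esub> \<phi> \<in> kernel_aut E K"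
    using b by (simp add: inv_BijGroup_UNIV)
next
  fix \<phi> \<psi> assume "\<phi> \<in> kernel_aut E K" "\<psi> \<in> kernel_aut E K"
  then show "\<phi> \<otimes>\<^bsub>BijGroup UNIV\<^esub> \<psi> \<in> kernel_aut E K"
    by (auto simp: kernel_aut_def mult_BijGroup_UNIV bij_comp)
qed

lemma group_Aut_K: "group (Aut_K E K)"
  unfolding Aut_K_def
  by (rule subgroup.subgroup_is_group[OF subgroup_kernel_aut group_BijGroup])

definition transporter :: "('v \<Rightarrow> 'v) set \<Rightarrow> 'v \<Rightarrow> 'v \<Rightarrow> ('v \<Rightarrow> 'v) set" where
  "transporter \<Gamma> u v = {\<phi> \<in> \<Gamma>. \<phi> u = v}"

text \<open>The orbit of \<open>v\<close> under the stabilizer of \<open>u\<close>.\<close>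

definition stab_orbit :: "('v \<Rightarrow> 'v) set \<Rightarrow> 'v \<Rightarrow> 'v \<Rightarrow> 'v set" where
  "stab_orbit \<Gamma> u v = (\<lambda>\<phi>. \<phi> v) ` transporter \<Gamma> u u"

definition transitive_triple :: "('v \<Rightarrow> 'v) set \<Rightarrow> bool" where
  "transitive_triple \<Gamma> \<longleftrightarrow> (\<forall>u v. transporter \<Gamma> u v \<noteq> {})"

definition unimodular_triple :: "('v \<Rightarrow> 'v) set \<Rightarrow> bool" where
  "unimodular_triple \<Gamma> \<longleftrightarrow>
     (\<forall>u v. finite (stab_orbit \<Gamma> u v) \<and> finite (stab_orbit \<Gamma> v u) \<and>
            card (stab_orbit \<Gamma> u v) = card (stab_orbit \<Gamma> v u))"

definition infinitely_accessible ::
  "('v \<Rightarrow> 'v \<Rightarrow> bool) \<Rightarrow> ('v \<Rightarrow> 'v \<Rightarrow> real) \<Rightarrow> ('v \<Rightarrow> 'v) set \<Rightarrow> bool" where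
  "infinitely_accessible E K \<Gamma> \<longleftrightarrow>
     (\<exists>\<phi>\<in>\<Gamma>. \<exists>u. infinite {(\<phi> ^^ n) u | n. True} \<and> accessible_from E K u (\<phi> u))"

text \<open>
  The dynamics for given initial configuration \<open>c\<close> (\<open>c v\<close>: a car starts at \<open>v\<close>; otherwise \<open>v\<close>
  is a parking spot), walks \<open>X\<close> and tie-breaking values \<open>U\<close>. Cars are named by their starting
  vertices. \<open>parked_at c X U t v = Some x\<close> means that the car from \<open>v\<close> has parked at \<open>x\<close> by time
  \<open>t\<close>; an unparked car from \<open>v\<close> is at \<open>X v t\<close> at time \<open>t\<close>, and the values of \<open>X v\<close> after the
  parking time are never looked at. The contenders for \<open>X v (Suc t)\<close> are all the cars that were
  unparked at time \<open>t\<close> and step there at time \<open>Suc t\<close>. The strict inequality leaves a spot empty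
  if its contenders have no unique minimum, which is a null event in the process below.
\<close>

primrec parked_at ::
  "('v \<Rightarrow> bool) \<Rightarrow> ('v \<Rightarrow> nat \<Rightarrow> 'v) \<Rightarrow> ('v \<Rightarrow> nat \<Rightarrow> real) \<Rightarrow> nat \<Rightarrow> 'v \<Rightarrow> 'v option" where
  "parked_at c X U 0 = Map.empty"
| "parked_at c X U (Suc t) = (\<lambda>v.
     case parked_at c X U t v of
       Some x \<Rightarrow> Some x
     | None \<Rightarrow>
         if c v \<and> \<not> c (X v (Suc t)) \<and> X v (Suc t) \<notin> ran (parked_at c X U t) \<and>
            (\<forall>w. w \<noteq> v \<and> c w \<and> parked_at c X U t w = None \<and> X w (Suc t) = X v (Suc t)
                 \<longrightarrow> U v (Suc t) < U w (Suc t))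
         then Some (X v (Suc t)) else None)"

definition car_parks ::
  "('v \<Rightarrow> bool) \<Rightarrow> ('v \<Rightarrow> nat \<Rightarrow> 'v) \<Rightarrow> ('v \<Rightarrow> nat \<Rightarrow> real) \<Rightarrow> 'v \<Rightarrow> bool" where
  "car_parks c X U v \<longleftrightarrow> (\<exists>t x. parked_at c X U t v = Some x)"

definition spot_filled ::
  "('v \<Rightarrow> bool) \<Rightarrow> ('v \<Rightarrow> nat \<Rightarrow> 'v) \<Rightarrow> ('v \<Rightarrow> nat \<Rightarrow> real) \<Rightarrow> 'v \<Rightarrow> bool" where
  "spot_filled c X U x \<longleftrightarrow> (\<exists>t v. parked_at c X U t v = Some x)"

text \<open>Index type for the independent sources of randomness.\<close>

datatype 'v source = Car 'v | Walk 'v | Tie 'v nat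

text \<open>
  The sigma-algebra generated by a source. A walk enters as one random trajectory, so that the
  walks are independent as processes while the steps of each of them are dependent.
\<close>

fun source_events ::
  "'w measure \<Rightarrow> ('v \<Rightarrow> 'w \<Rightarrow> bool) \<Rightarrow> ('v \<Rightarrow> nat \<Rightarrow> 'w \<Rightarrow> 'v) \<Rightarrow> ('v \<Rightarrow> nat \<Rightarrow> 'w \<Rightarrow> real)
     \<Rightarrow> 'v source \<Rightarrow> 'w set set" where
  "source_events M car walk tie (Car v) =
     sets (vimage_algebra (space M) (car v) (count_space UNIV))"
| "source_events M car walk tie (Walk v) =
     sets (vimage_algebra (space M) (\<lambda>\<omega> t. walk v t \<omega>) (\<Pi>\<^sub>M t\<in>UNIV. count_space UNIV))"
| "source_events M car walk tie (Tie v t) =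
     sets (vimage_algebra (space M) (tie v t) borel)"

text \<open>
  A realisation, on an arbitrary probability space, of the randomness driving the parking process
  with kernel \<open>K\<close> and density \<open>p\<close>. Walks and tie-breaking values are attached to every vertex;
  those of vertices without a car are not used by the dynamics.
\<close>

locale parking_process = prob_space M
  for M :: "'w measure" +
  fixes K :: "'v \<Rightarrow> 'v \<Rightarrow> real"
    and p :: real
    and car :: "'v \<Rightarrow> 'w \<Rightarrow> bool"
    and walk :: "'v \<Rightarrow> nat \<Rightarrow> 'w \<Rightarrow> 'v"
    and tie :: "'v \<Rightarrow> nat \<Rightarrow> 'w \<Rightarrow> real"
  assumes car_measurable: "\<And>v. car v \<in> M \<rightarrow>\<^sub>M count_space UNIV"
    and walk_measurable: "\<And>v t. walk v t \<in> M \<rightarrow>\<^sub>M count_space UNIV"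
    and tie_measurable: "\<And>v t. tie v t \<in> M \<rightarrow>\<^sub>M borel"
    and car_law: "\<And>v. \<P>(\<omega> in M. car v \<omega>) = p"
    and walk_law: "\<And>v n x. \<P>(\<omega> in M. \<forall>i\<le>n. walk v i \<omega> = x i) =
           (if x 0 = v then \<Prod>i<n. K (x i) (x (Suc i)) else 0)"
    and tie_law: "\<And>v t. distr M borel (tie v t) = uniform_measure lborel {0..1}"
    and independent: "indep_sets (source_events M car walk tie) UNIV"

end

theory Submission
  imports Defs
begin

text \<open>
  Let \<open>q\<close> be the probability that a car starts at the root and eventually parks. By the mass
  transport principle (\<open>mass_transport\<close>), applied to the probability that the car from \<open>u\<close> parks
  at \<open>v\<close>, \<open>q\<close> is also the probability that the root is a spot which eventually gets filled
  (\<open>prob_parks_eq_filled\<close>). Hence \<open>q \<le> min p (1 - p)\<close>, and both formulas say that equality holds.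
  What has to be excluded is that with positive probability a car drives forever and with positive
  probability a spot stays empty forever (\<open>prob_car_parks\<close>).

  Suppose that \<open>q < p\<close>, so that cars drive forever with density \<open>p - q\<close>. By mass transport the
  expected number of unparked cars at the root is at least \<open>p - q\<close> at every time. It is bounded by
  the number of all walks that are at the root at this time, parked or not; these are independent
  and have mean number 1, so that the second moment is at most 2. A count with mean bounded below
  and second moment bounded above is positive with probability bounded below. Therefore the root is
  visited infinitely often by unparked cars with positive probability (\<open>visited_io_positive\<close>).

  This event has probability 0 or 1 (\<open>visited_io_zero_one\<close>). If \<open>K a b > 0\<close>, then almost surely
  infinitely many visits to \<open>a\<close> entail infinitely many to \<open>b\<close>: each visit is a chance to step to
  \<open>b\<close>, and at most one of the arrivals at \<open>b\<close> ends there (\<open>AE_visited_io_neighbour\<close>). With \<open>u\<close>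
  accessible from \<open>\<phi> u\<close>, infinitely many visits to \<open>\<phi> u\<close> thus entail infinitely many to \<open>u\<close>; the
  two events have the same probability, so they agree up to a null set. On the other hand some
  power of \<open>\<phi>\<close> moves a given finite set of vertices off itself (\<open>funpow_displaces_finite\<close>), so that
  by independence an almost surely \<open>\<phi>\<close>-invariant event is independent of itself (\<open>zero_one_law\<close>).

  So the root is visited infinitely often almost surely, and a spot is filled as soon as an
  unparked car visits it (\<open>AE_visited_spot_filled\<close>): if \<open>q < p\<close>, then \<open>q = 1 - p\<close>.
\<close>

section \<open>Groups of kernel automorphisms and mass transport\<close>

locale vertex_group =
  fixes \<Gamma> :: "('v \<Rightarrow> 'v) set"
  assumes bij_member: "\<phi> \<in> \<Gamma> \<Longrightarrow> bij \<phi>"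
    and id_member: "id \<in> \<Gamma>"
    and comp_member: "\<phi> \<in> \<Gamma> \<Longrightarrow> \<psi> \<in> \<Gamma> \<Longrightarrow> \<phi> \<circ> \<psi> \<in> \<Gamma>"
    and inv_member: "\<phi> \<in> \<Gamma> \<Longrightarrow> inv_into UNIV \<phi> \<in> \<Gamma>"
    and unimodular: "unimodular_triple \<Gamma>"
begin

lemma funpow_member: "\<phi> \<in> \<Gamma> \<Longrightarrow> \<phi> ^^ n \<in> \<Gamma>"
  by (induction n) (auto simp: id_member[unfolded id_def] id_def intro: comp_member)

lemma inv_app: "\<phi> \<in> \<Gamma> \<Longrightarrow> inv_into UNIV \<phi> (\<phi> x) = x"
  using bij_member[of \<phi>] by (simp add: bij_is_inj)

lemma app_inv: "\<phi> \<in> \<Gamma> \<Longrightarrow> \<phi> (inv_into UNIV \<phi> x) = x"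
  using bij_member[of \<phi>] by (simp add: bij_is_surj surj_f_inv_f)

lemma inv_eq_iff: "\<phi> \<in> \<Gamma> \<Longrightarrow> inv_into UNIV \<phi> x = y \<longleftrightarrow> x = \<phi> y"
  using inv_app[of \<phi> y] app_inv[of \<phi> x] by auto

lemma card_stab_orbit_swap: "card (stab_orbit \<Gamma> u v) = card (stab_orbit \<Gamma> v u)"
  and finite_stab_orbit: "finite (stab_orbit \<Gamma> u v)"
  using unimodular unfolding unimodular_triple_def by blast+

lemma stab_orbitI: "h \<in> \<Gamma> \<Longrightarrow> h u = u \<Longrightarrow> x = h v \<Longrightarrow> x \<in> stab_orbit \<Gamma> u v"
  by (auto simp: stab_orbit_def transporter_def)

lemma stab_orbit_image:
  assumes g: "g \<in> \<Gamma>"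
  shows "stab_orbit \<Gamma> (g u) (g v) = g ` stab_orbit \<Gamma> u v"
proof
  show "stab_orbit \<Gamma> (g u) (g v) \<subseteq> g ` stab_orbit \<Gamma> u v"
  proof
    fix x assume "x \<in> stab_orbit \<Gamma> (g u) (g v)"
    then obtain h where h: "h \<in> \<Gamma>" "h (g u) = g u" "x = h (g v)"
      by (auto simp: stab_orbit_def transporter_def)
    have "inv_into UNIV g \<circ> (h \<circ> g) \<in> \<Gamma>"
      using g h by (intro comp_member inv_member)
    moreover have "(inv_into UNIV g \<circ> (h \<circ> g)) u = u"
      using g h by (simp add: inv_app)
    moreover have "x = g ((inv_into UNIV g \<circ> (h \<circ> g)) v)"
      using g h by (simp add: app_inv)
    ultimately show "x \<in> g ` stab_orbit \<Gamma> u v"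
      by (intro image_eqI[OF _ stab_orbitI[OF _ _ refl]])
  qed
  show "g ` stab_orbit \<Gamma> u v \<subseteq> stab_orbit \<Gamma> (g u) (g v)"
  proof
    fix x assume "x \<in> g ` stab_orbit \<Gamma> u v"
    then obtain h where h: "h \<in> \<Gamma>" "h u = u" "x = g (h v)"
      by (auto simp: stab_orbit_def transporter_def)
    have "g \<circ> (h \<circ> inv_into UNIV g) \<in> \<Gamma>"
      using g h by (intro comp_member inv_member)
    moreover have "(g \<circ> (h \<circ> inv_into UNIV g)) (g u) = g u"
      using g h by (simp add: inv_app)
    moreover have "x = (g \<circ> (h \<circ> inv_into UNIV g)) (g v)"
      using g h by (simp add: inv_app)
    ultimately show "x \<in> stab_orbit \<Gamma> (g u) (g v)"
      by (rule stab_orbitI)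
  qed
qed

lemma card_stab_orbit_image:
  assumes "g \<in> \<Gamma>"
  shows "card (stab_orbit \<Gamma> (g u) (g v)) = card (stab_orbit \<Gamma> u v)"
  using assms bij_member[of g]
  by (simp add: stab_orbit_image card_image bij_is_inj inj_on_subset[of g UNIV])

text \<open>
  Membership \<open>w \<in> mirror r v\<close> says that some member of the group carries the pair \<open>(r, v)\<close> to
  \<open>(w, r)\<close>: what \<open>r\<close> sends to \<open>v\<close> under an invariant mass function is what \<open>w\<close> sends to \<open>r\<close>.
\<close>

definition mirror :: "'v \<Rightarrow> 'v \<Rightarrow> 'v set" where
  "mirror r v = (\<lambda>g. g r) ` transporter \<Gamma> v r"

lemma mirrorI: "g \<in> \<Gamma> \<Longrightarrow> g v = r \<Longrightarrow> w = g r \<Longrightarrow> w \<in> mirror r v"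
  by (auto simp: mirror_def transporter_def)

text \<open>
  The inverse of an element carrying \<open>(r, v)\<close> to \<open>(w, r)\<close> carries \<open>(r, w)\<close> to \<open>(v, r)\<close>.
\<close>

lemma mirror_sym: "w \<in> mirror r v \<longleftrightarrow> v \<in> mirror r w"
proof -
  have "v \<in> mirror r w" if "w \<in> mirror r v" for v w
  proof -
    from that obtain g where g: "g \<in> \<Gamma>" "g v = r" "w = g r"
      by (auto simp: mirror_def transporter_def)
    then have "inv_into UNIV g \<in> \<Gamma>" "inv_into UNIV g w = r" "v = inv_into UNIV g r"
      by (auto simp: inv_member inv_app)
    then show ?thesis
      by (rule mirrorI)
  qed
  then show ?thesis by blast
qed

lemma mirror_eq:
  assumes g: "g \<in> \<Gamma>" "g v = r"
  shows "mirror r v = g ` stab_orbit \<Gamma> v r"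
proof
  show "mirror r v \<subseteq> g ` stab_orbit \<Gamma> v r"
  proof
    fix w assume "w \<in> mirror r v"
    then obtain h where h: "h \<in> \<Gamma>" "h v = r" "w = h r"
      by (auto simp: mirror_def transporter_def)
    then have "inv_into UNIV g \<circ> h \<in> \<Gamma>" "(inv_into UNIV g \<circ> h) v = v" "w = g ((inv_into UNIV g \<circ> h) r)"
      using g by (auto simp: inv_member comp_member inv_eq_iff app_inv)
    then show "w \<in> g ` stab_orbit \<Gamma> v r"
      by (intro image_eqI[OF _ stab_orbitI[OF _ _ refl]])
  qed
  show "g ` stab_orbit \<Gamma> v r \<subseteq> mirror r v"
  proof
    fix w assume "w \<in> g ` stab_orbit \<Gamma> v r"
    then obtain h where h: "h \<in> \<Gamma>" "h v = v" "w = g (h r)"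
      by (auto simp: stab_orbit_def transporter_def)
    then have "g \<circ> h \<in> \<Gamma>" "(g \<circ> h) v = r" "w = (g \<circ> h) r"
      using g by (auto simp: comp_member)
    then show "w \<in> mirror r v"
      by (rule mirrorI)
  qed
qed

lemma card_mirror:
  assumes "g \<in> \<Gamma>" "g v = r"
  shows "card (mirror r v) = card (stab_orbit \<Gamma> r v)" "finite (mirror r v)"
  using assms bij_member[of g]
  by (simp_all add: mirror_eq card_image bij_is_inj inj_on_subset[of g UNIV]
      card_stab_orbit_swap[of r v] finite_stab_orbit)

text \<open>
  Let \<open>g v = r\<close> and \<open>w = g r\<close>. Unimodularity turns the orbit of \<open>w\<close> under the stabilizer of \<open>r\<close>
  into the orbit of \<open>r = g v\<close> under the stabilizer of \<open>w = g r\<close>, which is the \<open>g\<close>-image of the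
  orbit of \<open>v\<close> under the stabilizer of \<open>r\<close>.
\<close>

lemma card_mirror_sym:
  assumes "w \<in> mirror r v"
  shows "card (mirror r w) = card (mirror r v)"
proof -
  obtain g where g: "g \<in> \<Gamma>" "g v = r" "w = g r"
    using assms by (auto simp: mirror_def transporter_def)
  obtain h where h: "h \<in> \<Gamma>" "h w = r"
    using assms by (auto simp: mirror_sym[of w] mirror_def[of r w] transporter_def)
  have "card (mirror r w) = card (stab_orbit \<Gamma> (g r) (g v))"
    using h g card_stab_orbit_swap[of r w] by (simp add: card_mirror)
  also have "\<dots> = card (mirror r v)"
    using card_stab_orbit_image[OF g(1), of r v] card_mirror(1)[OF g(1,2)] by simp
  finally show ?thesis .
qed

text \<open>
  Spread the mass \<open>f r v\<close> evenly over the vertices \<open>w\<close> of \<open>mirror r v\<close>, for which \<open>f r v = f w r\<close>.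
  As the relation is symmetric and related vertices have mirrors of the same size, summing over \<open>v\<close>
  first leaves exactly \<open>f w r\<close> at \<open>w\<close>.
\<close>

theorem mass_transport:
  fixes f :: "'v \<Rightarrow> 'v \<Rightarrow> ennreal"
  assumes trans: "transitive_triple \<Gamma>"
    and inv: "\<And>\<phi> u v. \<phi> \<in> \<Gamma> \<Longrightarrow> f (\<phi> u) (\<phi> v) = f u v"
  shows "(\<integral>\<^sup>+ v. f r v \<partial>count_space UNIV) = (\<integral>\<^sup>+ v. f v r \<partial>count_space UNIV)"
proof -
  \<comment> \<open>The share that each vertex of \<open>mirror r v\<close> receives of a unit mass.\<close>
  define k where "k = (\<lambda>v. ennreal (1 / real (card (mirror r v))))"
  have ex: "\<exists>g\<in>\<Gamma>. g v = r" for v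
    using trans unfolding transitive_triple_def transporter_def by blast
  have fin: "finite (mirror r v)" for v
    using ex[of v] card_mirror(2) by blast
  have "mirror r v \<noteq> {}" for v
    using ex[of v] by (auto simp: mirror_def transporter_def)
  then have pos: "card (mirror r v) > 0" for v
    using fin by (simp add: card_gt_0_iff)
  have spread: "(\<integral>\<^sup>+ w. k v * indicator (mirror r v) w \<partial>count_space UNIV) = 1" for v
  proof -
    have "(\<integral>\<^sup>+ w. k v * indicator (mirror r v) w \<partial>count_space UNIV)
        = k v * ennreal (real (card (mirror r v)))"
      using fin[of v] by (subst nn_integral_cmult_indicator) (auto simp: emeasure_count_space ennreal_of_nat_eq_real_of_nat)
    also have "\<dots> = 1"
      using pos[of v] by (simp add: k_def flip: ennreal_mult)
    finally show ?thesis .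
  qed
  have move: "f r v * (k v * indicator (mirror r v) w) = f w r * (k w * indicator (mirror r w) v)"
    for v w
  proof (cases "w \<in> mirror r v")
    case True
    then obtain g where g: "g \<in> \<Gamma>" "g v = r" "w = g r"
      by (auto simp: mirror_def transporter_def)
    then have "f w r = f r v"
      using inv[of g r v] by simp
    moreover have "k w = k v"
      using True by (simp add: k_def card_mirror_sym)
    ultimately show ?thesis
      using True mirror_sym[of w r v] by simp
  next
    case False
    then show ?thesis using mirror_sym[of w r v] by simp
  qed
  have "(\<integral>\<^sup>+ v. f r v \<partial>count_space UNIV)
      = (\<integral>\<^sup>+ v. (\<integral>\<^sup>+ w. f r v * (k v * indicator (mirror r v) w) \<partial>count_space UNIV) \<partial>count_space UNIV)"
    by (intro nn_integral_cong) (simp add: nn_integral_cmult spread)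
  also have "\<dots> = (\<integral>\<^sup>+ w. (\<integral>\<^sup>+ v. f r v * (k v * indicator (mirror r v) w) \<partial>count_space UNIV) \<partial>count_space UNIV)"
    using nn_integral_fst_count_space[of "\<lambda>(v, w). f r v * (k v * indicator (mirror r v) w)"]
      nn_integral_snd_count_space[of "\<lambda>(v, w). f r v * (k v * indicator (mirror r v) w)"]
    by simp
  also have "\<dots> = (\<integral>\<^sup>+ w. (\<integral>\<^sup>+ v. f w r * (k w * indicator (mirror r w) v) \<partial>count_space UNIV) \<partial>count_space UNIV)"
    by (intro nn_integral_cong move)
  also have "\<dots> = (\<integral>\<^sup>+ w. f w r \<partial>count_space UNIV)"
    by (intro nn_integral_cong) (simp add: nn_integral_cmult spread)
  finally show ?thesis .
qed

text \<open>
  If \<open>\<phi> ^^ d\<close> fixed \<open>w\<close>, then its powers would keep \<open>u\<close> inside the orbit of \<open>u\<close> under the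
  stabilizer of \<open>w\<close>, which is finite.
\<close>

lemma funpow_no_return:
  assumes \<phi>: "\<phi> \<in> \<Gamma>" and inf: "infinite {(\<phi> ^^ n) u | n. True}"
  shows "inj (\<lambda>n. (\<phi> ^^ n) w)"
proof (rule ccontr)
  assume "\<not> inj (\<lambda>n. (\<phi> ^^ n) w)"
  then obtain m n where mn: "m < n" "(\<phi> ^^ m) w = (\<phi> ^^ n) w"
    unfolding inj_def by (metis linorder_neqE_nat)
  define d where "d = n - m"
  have "d > 0" using mn by (simp add: d_def)
  have "(\<phi> ^^ m) w = (\<phi> ^^ m) ((\<phi> ^^ d) w)"
    using mn funpow_add[of m d \<phi>] by (simp add: d_def)
  then have ret: "(\<phi> ^^ d) w = w"
    using bij_member[OF funpow_member[OF \<phi>, of m]] by (metis bij_is_inj injD)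
  have ret': "(\<phi> ^^ (d * k)) w = w" for k
    by (induction k) (auto simp: funpow_add ret)
  have orb: "(\<phi> ^^ (d * k)) u \<in> stab_orbit \<Gamma> w u" for k
    using ret' funpow_member[OF \<phi>] by (auto simp: stab_orbit_def transporter_def)
  have "{(\<phi> ^^ n) u | n. True} \<subseteq> (\<Union>j<d. (\<phi> ^^ j) ` stab_orbit \<Gamma> w u)"
  proof
    fix x assume "x \<in> {(\<phi> ^^ n) u | n. True}"
    then obtain n where x: "x = (\<phi> ^^ n) u" by blast
    have "x = (\<phi> ^^ (n mod d)) ((\<phi> ^^ (d * (n div d))) u)"
      using funpow_add[of "n mod d" "d * (n div d)" \<phi>] by (simp add: x)
    then show "x \<in> (\<Union>j<d. (\<phi> ^^ j) ` stab_orbit \<Gamma> w u)"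
      using orb[of "n div d"] \<open>d > 0\<close> by (intro UN_I[of "n mod d"]) auto
  qed
  then have "finite {(\<phi> ^^ n) u | n. True}"
    by (rule finite_subset) (auto simp: finite_stab_orbit)
  with inf show False by blast
qed

lemma funpow_displaces_finite:
  assumes \<phi>: "\<phi> \<in> \<Gamma>" and inf: "infinite {(\<phi> ^^ n) u | n. True}" and F: "finite F"
  shows "\<exists>n. (\<phi> ^^ n) ` F \<inter> F = {}"
proof -
  have "finite (\<Union>w\<in>F. (\<lambda>n. (\<phi> ^^ n) w) -` F)"
    using F funpow_no_return[OF \<phi> inf] by (intro finite_UN_I finite_vimageI)
  then obtain n where "n \<notin> (\<Union>w\<in>F. (\<lambda>n. (\<phi> ^^ n) w) -` F)"
    using ex_new_if_finite infinite_UNIV_nat by blast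
  then show ?thesis by (intro exI[of _ n]) auto
qed

end

lemma vertex_groupI:
  assumes sub: "subgroup \<Gamma> (Aut_K E K)" and uni: "unimodular_triple \<Gamma>"
  shows "vertex_group \<Gamma>"
proof -
  interpret A: group "Aut_K E K" by (rule group_Aut_K)
  interpret S: subgroup \<Gamma> "Aut_K E K" by (rule sub)
  have bij: "bij \<phi>" if "\<phi> \<in> \<Gamma>" for \<phi>
    using that S.subset by (auto simp: Aut_K_def kernel_aut_def)
  have mult: "\<phi> \<otimes>\<^bsub>Aut_K E K\<^esub> \<psi> = \<phi> \<circ> \<psi>" if "\<phi> \<in> \<Gamma>" "\<psi> \<in> \<Gamma>" for \<phi> \<psi>
    using mult_BijGroup_UNIV[OF bij[OF that(1)] bij[OF that(2)]] by (simp add: Aut_K_def)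
  have one: "\<one>\<^bsub>Aut_K E K\<^esub> = id"
    by (simp add: Aut_K_def BijGroup_def id_def restrict_def)
  show ?thesis
  proof
    fix \<phi> \<psi> assume \<phi>: "\<phi> \<in> \<Gamma>"
    show "bij \<phi>" by (rule bij[OF \<phi>])
    show "\<phi> \<circ> \<psi> \<in> \<Gamma>" if "\<psi> \<in> \<Gamma>"
      using S.m_closed[OF \<phi> that] by (simp add: mult \<phi> that)
    have "inv\<^bsub>Aut_K E K\<^esub> \<phi> \<in> \<Gamma>" using \<phi> by (rule S.m_inv_closed)
    moreover have "inv\<^bsub>Aut_K E K\<^esub> \<phi> \<circ> \<phi> = id"
      using A.l_inv[of \<phi>] \<phi> S.subset calculation by (auto simp: mult one)
    then have "inv\<^bsub>Aut_K E K\<^esub> \<phi> = inv_into UNIV \<phi>"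
      using bij[OF \<phi>] by (intro ext) (metis bij_is_surj comp_apply id_apply surj_f_inv_f)
    ultimately show "inv_into UNIV \<phi> \<in> \<Gamma>" by simp
  next
    show "id \<in> \<Gamma>" using S.one_closed by (simp add: one)
  qed (rule uni)
qed

lemma Aut_K_kernel_eq:
  assumes "subgroup \<Gamma> (Aut_K E K)" "\<phi> \<in> \<Gamma>"
  shows "K (\<phi> u) (\<phi> v) = K u v"
  using subgroup.subset[OF assms(1)] assms(2) by (auto simp: Aut_K_def kernel_aut_def)

text \<open>
  The vertices are exhausted by the finite balls around one of them.
\<close>

lemma connected_locally_finite_countable:
  fixes E :: "'v \<Rightarrow> 'v \<Rightarrow> bool"
  assumes "locally_finite_graph E" "connected_graph E"
  shows "countable (UNIV :: 'v set)"
proof -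
  fix r :: 'v
  define B where "B = (\<lambda>n. ((\<lambda>S. \<Union>v\<in>S. nbhd E v) ^^ n) {r})"
  have "finite (B n)" for n
    using assms(1) by (induction n) (auto simp: B_def locally_finite_graph_def)
  then have "countable (\<Union>n. B n)"
    by (intro countable_UN) (auto intro: countable_finite)
  moreover have "v \<in> (\<Union>n. B n)" for v
  proof -
    have "E\<^sup>*\<^sup>* r v" using assms(2) by (simp add: connected_graph_def)
    then show ?thesis
    proof induction
      case base
      then show ?case by (auto simp: B_def intro!: exI[of _ 0])
    next
      case (step y z)
      then obtain n where "y \<in> B n" by blast
      with step have "z \<in> B (Suc n)" by (auto simp: B_def nbhd_def)
      then show ?case by blast
    qed
  qed
  ultimately show ?thesis by (metis UNIV_eq_I)
qed

section \<open>The dynamics for a fixed configuration\<close>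

definition unparked ::
  "('v \<Rightarrow> bool) \<Rightarrow> ('v \<Rightarrow> nat \<Rightarrow> 'v) \<Rightarrow> ('v \<Rightarrow> nat \<Rightarrow> real) \<Rightarrow> nat \<Rightarrow> 'v \<Rightarrow> bool" where
  "unparked c X U t v \<longleftrightarrow> c v \<and> parked_at c X U t v = None"

definition occupied ::
  "('v \<Rightarrow> bool) \<Rightarrow> ('v \<Rightarrow> nat \<Rightarrow> 'v) \<Rightarrow> ('v \<Rightarrow> nat \<Rightarrow> real) \<Rightarrow> nat \<Rightarrow> 'v \<Rightarrow> bool" where
  "occupied c X U t x \<longleftrightarrow> (\<exists>w. unparked c X U t w \<and> X w t = x)"

definition visited_io ::
  "('v \<Rightarrow> bool) \<Rightarrow> ('v \<Rightarrow> nat \<Rightarrow> 'v) \<Rightarrow> ('v \<Rightarrow> nat \<Rightarrow> real) \<Rightarrow> 'v \<Rightarrow> bool" where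
  "visited_io c X U x \<longleftrightarrow> (\<forall>n. \<exists>t\<ge>n. occupied c X U t x)"

lemma parked_at_mono:
  assumes "parked_at c X U s v = Some x" "s \<le> t"
  shows "parked_at c X U t v = Some x"
  using assms(2,1) by (induction t rule: dec_induct) auto

lemma parked_at_SucD:
  assumes "parked_at c X U (Suc t) v = Some x" "parked_at c X U t v = None"
  shows "c v" "\<not> c x" "x = X v (Suc t)" "x \<notin> ran (parked_at c X U t)"
    "\<And>w. w \<noteq> v \<Longrightarrow> unparked c X U t w \<Longrightarrow> X w (Suc t) = x \<Longrightarrow> U v (Suc t) < U w (Suc t)"
  using assms by (auto simp: unparked_def split: if_splits)

lemma parked_at_car_spot:
  assumes "parked_at c X U t v = Some x"
  shows "c v \<and> \<not> c x"
  using assms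
proof (induction t)
  case (Suc t)
  show ?case
  proof (cases "parked_at c X U t v")
    case None
    then show ?thesis using parked_at_SucD[OF Suc.prems] by blast
  next
    case (Some y)
    then show ?thesis using Suc.IH Suc.prems by simp
  qed
qed simp

text \<open>
  A car cannot join an occupied spot, and of two cars that park in a spot simultaneously each
  would have the strictly smaller tie-breaking value.
\<close>

lemma parked_at_unique_same_time:
  assumes "parked_at c X U t v = Some x" "parked_at c X U t w = Some x"
  shows "v = w"
  using assms
proof (induction t)
  case (Suc t)
  have fresh: False if "parked_at c X U t a = None" "parked_at c X U t b = Some x"
    "parked_at c X U (Suc t) a = Some x" for a b
    using parked_at_SucD(4)[OF that(3,1)] that(2) by (auto simp: ran_def)
  show ?case
  proof (cases "parked_at c X U t v"; cases "parked_at c X U t w")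
    assume v: "parked_at c X U t v = None" and w: "parked_at c X U t w = None"
    show ?thesis
    proof (rule ccontr)
      assume "v \<noteq> w"
      note V = parked_at_SucD[OF Suc.prems(1) v] and W = parked_at_SucD[OF Suc.prems(2) w]
      have "U v (Suc t) < U w (Suc t)"
        using \<open>v \<noteq> w\<close> W w by (intro V(5)) (auto simp: unparked_def)
      moreover have "U w (Suc t) < U v (Suc t)"
        using \<open>v \<noteq> w\<close> V v by (intro W(5)) (auto simp: unparked_def)
      ultimately show False by simp
    qed
  next
    fix y assume "parked_at c X U t v = None" "parked_at c X U t w = Some y"
    then show ?thesis using fresh[of v w] Suc.prems parked_at_mono[of c X U t w y "Suc t"] by simp
  next
    fix y assume "parked_at c X U t v = Some y" "parked_at c X U t w = None"
    then show ?thesis using fresh[of w v] Suc.prems parked_at_mono[of c X U t v y "Suc t"] by simp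
  next
    fix y z assume "parked_at c X U t v = Some y" "parked_at c X U t w = Some z"
    then show ?thesis using Suc by simp
  qed
qed simp

lemma parked_at_unique:
  assumes "parked_at c X U s v = Some x" "parked_at c X U t w = Some x"
  shows "v = w"
  using parked_at_mono[OF assms(1) max.cobounded1[of s t]]
    parked_at_mono[OF assms(2) max.cobounded2[of t s]]
  by (rule parked_at_unique_same_time)

lemma parked_at_cong:
  assumes "\<And>w i. i \<le> t \<Longrightarrow> X w i = X' w i"
  shows "parked_at c X U t = parked_at c X' U t"
  using assms
proof (induction t)
  case (Suc t)
  have "parked_at c X U t = parked_at c X' U t" by (rule Suc.IH) (simp add: Suc.prems)
  moreover have "X w (Suc t) = X' w (Suc t)" for w by (simp add: Suc.prems)
  ultimately show ?case by (simp only: parked_at.simps)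
qed simp

lemma parked_at_equivariant:
  fixes \<phi> :: "'v \<Rightarrow> 'v"
  assumes \<phi>: "bij \<phi>"
  shows "parked_at (\<lambda>v. c (\<phi> v)) (\<lambda>v t. inv_into UNIV \<phi> (X (\<phi> v) t)) (\<lambda>v. U (\<phi> v)) t v
    = map_option (inv_into UNIV \<phi>) (parked_at c X U t (\<phi> v))"
proof (induction t arbitrary: v)
  case (Suc t)
  let ?\<psi> = "inv_into UNIV \<phi>"
  let ?P = "parked_at (\<lambda>v. c (\<phi> v)) (\<lambda>v t. ?\<psi> (X (\<phi> v) t)) (\<lambda>v. U (\<phi> v))"
  have l: "?\<psi> (\<phi> x) = x" and r: "\<phi> (?\<psi> x) = x" for x
    using \<phi> by (simp_all add: bij_is_inj bij_is_surj surj_f_inv_f)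
  have psi_eq: "?\<psi> x = ?\<psi> y \<longleftrightarrow> x = y" for x y by (metis r)
  have phi_eq: "\<phi> x = \<phi> y \<longleftrightarrow> x = y" for x y by (metis l)
  have all: "(\<forall>w. P (\<phi> w)) \<longleftrightarrow> (\<forall>w. P w)" for P by (metis r)
  have ran: "?\<psi> x \<in> ran (?P t) \<longleftrightarrow> x \<in> ran (parked_at c X U t)" for x
  proof -
    have "?\<psi> x \<in> ran (?P t) \<longleftrightarrow> (\<exists>v. parked_at c X U t (\<phi> v) = Some x)"
      by (auto simp: ran_def Suc psi_eq)
    also have "\<dots> \<longleftrightarrow> x \<in> ran (parked_at c X U t)"
      by (auto simp: ran_def) (metis r)
    finally show ?thesis .
  qed
  have "(\<forall>w. w \<noteq> v \<and> c (\<phi> w) \<and> ?P t w = None \<and> ?\<psi> (X (\<phi> w) (Suc t)) = ?\<psi> (X (\<phi> v) (Suc t))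
           \<longrightarrow> U (\<phi> v) (Suc t) < U (\<phi> w) (Suc t)) \<longleftrightarrow>
        (\<forall>w. w \<noteq> \<phi> v \<and> c w \<and> parked_at c X U t w = None \<and> X w (Suc t) = X (\<phi> v) (Suc t)
           \<longrightarrow> U (\<phi> v) (Suc t) < U w (Suc t))"
    by (subst (2) all[symmetric]) (simp add: Suc psi_eq phi_eq)
  then show ?case
    by (simp add: Suc ran r split: option.split) fastforce
qed simp

lemma unparked_equivariant:
  fixes \<phi> :: "'v \<Rightarrow> 'v"
  assumes "bij \<phi>"
  shows "unparked (\<lambda>v. c (\<phi> v)) (\<lambda>v t. inv_into UNIV \<phi> (X (\<phi> v) t)) (\<lambda>v. U (\<phi> v)) t v
    \<longleftrightarrow> unparked c X U t (\<phi> v)"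
  by (simp add: unparked_def parked_at_equivariant[OF assms])

lemma visited_io_equivariant:
  fixes \<phi> :: "'v \<Rightarrow> 'v"
  assumes \<phi>: "bij \<phi>"
  shows "visited_io (\<lambda>v. c (\<phi> v)) (\<lambda>v t. inv_into UNIV \<phi> (X (\<phi> v) t)) (\<lambda>v. U (\<phi> v)) x
    \<longleftrightarrow> visited_io c X U (\<phi> x)"
proof -
  have eq: "inv_into UNIV \<phi> y = z \<longleftrightarrow> y = \<phi> z" for y z
    using \<phi> by (metis bij_inv_eq_iff)
  have "occupied (\<lambda>v. c (\<phi> v)) (\<lambda>v t. inv_into UNIV \<phi> (X (\<phi> v) t)) (\<lambda>v. U (\<phi> v)) t x
      \<longleftrightarrow> occupied c X U t (\<phi> x)" for t
    unfolding occupied_def unparked_equivariant[OF \<phi>] eq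
    using \<phi> by (metis bij_pointE)
  then show ?thesis by (simp add: visited_io_def)
qed

text \<open>
  A car that is unparked on \<open>x\<close> at time \<open>Suc t\<close> was a contender for \<open>x\<close> at that time. If \<open>x\<close> was
  still empty, then the contender with the least tie-breaking value parked.
\<close>

lemma spot_filled_if_occupied:
  assumes spot: "\<not> c x" and occ: "occupied c X U (Suc t) x"
    and fin: "finite {w. X w (Suc t) = x}"
    and ties: "\<And>v w. v \<noteq> w \<Longrightarrow> U v (Suc t) \<noteq> U w (Suc t)"
  shows "spot_filled c X U x"
proof (cases "x \<in> ran (parked_at c X U t)")
  case True
  then show ?thesis by (auto simp: spot_filled_def ran_def)
next
  case False
  define C where "C = {w. unparked c X U t w \<and> X w (Suc t) = x}"
  have "finite C" using fin by (rule finite_subset[rotated]) (auto simp: C_def)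
  moreover obtain w where w: "unparked c X U (Suc t) w" "X w (Suc t) = x"
    using occ by (auto simp: occupied_def)
  then have "w \<in> C"
    using parked_at_mono[of c X U t w _ "Suc t"] 
    by (cases "parked_at c X U t w") (auto simp: C_def unparked_def)
  ultimately obtain v where v: "v \<in> C" and min: "\<And>w. w \<in> C \<Longrightarrow> U v (Suc t) \<le> U w (Suc t)"
    using ex_min_if_finite[of "(\<lambda>w. U w (Suc t)) ` C"] by (auto simp: not_less)
  have "U v (Suc t) < U w (Suc t)" if "w \<in> C" "w \<noteq> v" for w
    using min[OF that(1)] ties[of v w] that(2) by force
  then have "parked_at c X U (Suc t) v = Some x"
    using v False spot by (auto simp: C_def unparked_def)
  then show ?thesis unfolding spot_filled_def by blast
qed

text \<open>
  All arrivals of unparked cars at \<open>y\<close>, except for at most one, leave the car unparked at \<open>y\<close>.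
\<close>

lemma visited_io_step:
  assumes moves: "\<And>n. \<exists>t\<ge>n. \<exists>w. unparked c X U t w \<and> X w (Suc t) = y"
  shows "visited_io c X U y"
proof -
  define T where "T = {t. \<exists>w. parked_at c X U t w = None \<and> parked_at c X U (Suc t) w = Some y}"
  have one: False if ts: "t < s" "s \<in> T" "t \<in> T" for s t
  proof -
    obtain v w where v: "parked_at c X U (Suc t) v = Some y"
      and w: "parked_at c X U s w = None" "parked_at c X U (Suc s) w = Some y"
      using ts(2,3) unfolding T_def by blast
    have "v = w" using v w(2) by (rule parked_at_unique)
    moreover have "parked_at c X U s v = Some y" using v by (rule parked_at_mono) (use ts in simp)
    ultimately show False using w by simp
  qed
  have "\<exists>m. \<forall>t\<ge>m. t \<notin> T"
  proof (cases "T = {}")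
    case False
    then obtain t where "t \<in> T" by blast
    then show ?thesis using one[of t] by (intro exI[of _ "Suc t"]) (auto simp: Suc_le_eq)
  qed auto
  then obtain m where m: "\<And>t. t \<ge> m \<Longrightarrow> t \<notin> T" by blast
  show ?thesis unfolding visited_io_def
  proof
    fix n
    obtain t w where t: "t \<ge> max n m" "unparked c X U t w" "X w (Suc t) = y"
      using moves by blast
    have "parked_at c X U (Suc t) w = None"
    proof (rule ccontr)
      assume "parked_at c X U (Suc t) w \<noteq> None"
      then obtain z where z: "parked_at c X U (Suc t) w = Some z" by blast
      then have "z = y"
        using parked_at_SucD(3)[OF z] t by (simp add: unparked_def)
      then have "t \<in> T" using z t(2) unfolding T_def unparked_def by blast
      then show False using t(1) m[of t] by simp
    qed
    then have "occupied c X U (Suc t) y"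
      using t(2,3) unfolding occupied_def unparked_def by blast
    then show "\<exists>t\<ge>n. occupied c X U t y"
      using t(1) by (intro exI[of _ "Suc t"]) auto
  qed
qed

section \<open>The space of configurations\<close>

text \<open>
  All sources of randomness get outcomes in one common type, so that the law of a configuration is
  a product measure indexed by the sources. A source uses one of the three components; \<open>encode\<close>
  sets the others to fixed values, which makes a configuration a function of the data \<open>c\<close>, \<open>X\<close>
  and \<open>U\<close>.
\<close>

type_synonym 'v outcome = "bool \<times> (nat \<Rightarrow> 'v) \<times> real"
type_synonym 'v conf = "'v source \<Rightarrow> 'v outcome"

definition traj_space :: "(nat \<Rightarrow> 'v) measure" where
  "traj_space = (\<Pi>\<^sub>M t\<in>UNIV. count_space UNIV)"

definition outcome_space :: "'v outcome measure" where
  "outcome_space = count_space UNIV \<Otimes>\<^sub>M traj_space \<Otimes>\<^sub>M borel"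

definition conf_space :: "'v conf measure" where
  "conf_space = (\<Pi>\<^sub>M s\<in>UNIV. outcome_space)"

definition cars :: "'v conf \<Rightarrow> 'v \<Rightarrow> bool" where
  "cars y v = fst (y (Car v))"
definition walks :: "'v conf \<Rightarrow> 'v \<Rightarrow> nat \<Rightarrow> 'v" where
  "walks y v t = fst (snd (y (Walk v))) t"
definition ties :: "'v conf \<Rightarrow> 'v \<Rightarrow> nat \<Rightarrow> real" where
  "ties y v t = snd (snd (y (Tie v t)))"

fun encode :: "('v \<Rightarrow> bool) \<Rightarrow> ('v \<Rightarrow> nat \<Rightarrow> 'v) \<Rightarrow> ('v \<Rightarrow> nat \<Rightarrow> real) \<Rightarrow> 'v conf" where
  "encode c X U (Car v) = (c v, \<lambda>_. undefined, 0)"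
| "encode c X U (Walk v) = (False, X v, 0)"
| "encode c X U (Tie v t) = (False, \<lambda>_. undefined, U v t)"

lemma encode_simps [simp]:
  "cars (encode c X U) = c" "walks (encode c X U) = X" "ties (encode c X U) = U"
  by (auto simp: cars_def walks_def ties_def fun_eq_iff)

abbreviation "parked_in y \<equiv> parked_at (cars y) (walks y) (ties y)"
abbreviation "unparked_in y \<equiv> unparked (cars y) (walks y) (ties y)"
abbreviation "occupied_in y \<equiv> occupied (cars y) (walks y) (ties y)"
abbreviation "visited_io_in y \<equiv> visited_io (cars y) (walks y) (ties y)"

lemma space_traj_space [simp]: "space traj_space = UNIV"
  by (simp add: traj_space_def space_PiM)

lemma space_outcome_space [simp]: "space outcome_space = UNIV"
  by (simp add: outcome_space_def space_pair_measure)

lemma space_conf_space [simp]: "space conf_space = UNIV"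
  by (simp add: conf_space_def space_PiM)

lemma measurable_traj_at [measurable]: "(\<lambda>x. x t) \<in> traj_space \<rightarrow>\<^sub>M count_space UNIV"
  unfolding traj_space_def by measurable

lemma measurable_traj_spaceI:
  assumes "\<And>t. (\<lambda>\<omega>. f \<omega> t) \<in> M \<rightarrow>\<^sub>M count_space UNIV"
  shows "f \<in> M \<rightarrow>\<^sub>M traj_space"
  unfolding traj_space_def using assms
  by (intro measurable_PiM_single') (auto simp: space_PiM)

lemma measurable_source [measurable]: "(\<lambda>y. y s) \<in> conf_space \<rightarrow>\<^sub>M outcome_space"
  unfolding conf_space_def by measurable

lemma measurable_cars [measurable]: "(\<lambda>y. cars y v) \<in> conf_space \<rightarrow>\<^sub>M count_space UNIV"
  unfolding cars_def
  by (rule measurable_compose[OF measurable_source]) (simp add: outcome_space_def)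

lemma measurable_walks [measurable]: "(\<lambda>y. walks y v t) \<in> conf_space \<rightarrow>\<^sub>M count_space UNIV"
  unfolding walks_def
  by (rule measurable_compose[OF measurable_source]) (simp add: outcome_space_def)

lemma measurable_ties [measurable]: "(\<lambda>y. ties y v t) \<in> conf_space \<rightarrow>\<^sub>M borel"
  unfolding ties_def
  by (rule measurable_compose[OF measurable_source]) (simp add: outcome_space_def)

lemma measurable_encode:
  assumes "\<And>v. (\<lambda>\<omega>. c \<omega> v) \<in> M \<rightarrow>\<^sub>M count_space UNIV"
    and "\<And>v t. (\<lambda>\<omega>. X \<omega> v t) \<in> M \<rightarrow>\<^sub>M count_space UNIV"
    and "\<And>v t. (\<lambda>\<omega>. U \<omega> v t) \<in> M \<rightarrow>\<^sub>M borel"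
  shows "(\<lambda>\<omega>. encode (c \<omega>) (X \<omega>) (U \<omega>)) \<in> M \<rightarrow>\<^sub>M conf_space"
  unfolding conf_space_def
proof (rule measurable_PiM_single')
  show "(\<lambda>\<omega>. encode (c \<omega>) (X \<omega>) (U \<omega>) s) \<in> M \<rightarrow>\<^sub>M outcome_space" for s
    using assms
    by (cases s) (auto simp: outcome_space_def intro!: measurable_Pair measurable_traj_spaceI)
qed auto

text \<open>
  The vertex type is countable only by assumption, so that quantifiers over it are replaced by
  quantifiers over the natural numbers.
\<close>

lemma pred_ex_countable:
  fixes P :: "'i \<Rightarrow> 'a \<Rightarrow> bool"
  assumes "countable (UNIV :: 'i set)" "\<And>i. Measurable.pred M (P i)"
  shows "Measurable.pred M (\<lambda>x. \<exists>i. P i x)" "Measurable.pred M (\<lambda>x. \<forall>i. P i x)"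
proof -
  have surj: "range (from_nat_into (UNIV :: 'i set)) = UNIV"
    using assms(1) by (intro range_from_nat_into) auto
  have "(\<lambda>x. \<exists>i. P i x) = (\<lambda>x. \<exists>n. P (from_nat_into UNIV n) x)"
    "(\<lambda>x. \<forall>i. P i x) = (\<lambda>x. \<forall>n. P (from_nat_into UNIV n) x)"
    using surj by (metis rangeE UNIV_I)+
  moreover note assms(2)[measurable]
  ultimately show "Measurable.pred M (\<lambda>x. \<exists>i. P i x)" "Measurable.pred M (\<lambda>x. \<forall>i. P i x)"
    by simp_all
qed

lemma pred_eq_countable:
  fixes f g :: "'a \<Rightarrow> 'i"
  assumes "countable (UNIV :: 'i set)"
    and [measurable]: "f \<in> M \<rightarrow>\<^sub>M count_space UNIV" "g \<in> M \<rightarrow>\<^sub>M count_space UNIV"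
  shows "Measurable.pred M (\<lambda>x. f x = g x)"
proof -
  have "(\<lambda>x. f x = g x) = (\<lambda>x. \<exists>i. f x = i \<and> g x = i)" by auto
  then show ?thesis by (simp only:) (rule pred_ex_countable[OF assms(1)], measurable)
qed

context
  assumes countable_vertices: "countable (UNIV :: 'v set)"
begin

lemma measurable_parked_in:
  "(\<lambda>y :: 'v conf. parked_in y t v) \<in> conf_space \<rightarrow>\<^sub>M count_space UNIV"
proof (induction t arbitrary: v)
  case (Suc t)
  note [measurable] = Suc
  have cnt: "countable (UNIV :: 'v option set)"
    unfolding UNIV_option_conv using countable_vertices by simp
  have [measurable]: "Measurable.pred conf_space (\<lambda>y :: 'v conf. cars y (walks y v (Suc t)))"
  proof -
    have "(\<lambda>y :: 'v conf. cars y (walks y v (Suc t))) = (\<lambda>y. \<exists>x. walks y v (Suc t) = x \<and> cars y x)"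
      by auto
    then show ?thesis
      by (simp only:) (rule pred_ex_countable[OF countable_vertices], measurable)
  qed
  have [measurable]: "Measurable.pred conf_space
      (\<lambda>y :: 'v conf. walks y v (Suc t) \<notin> ran (parked_in y t))"
  proof -
    have "(\<lambda>y :: 'v conf. walks y v (Suc t) \<notin> ran (parked_in y t))
        = (\<lambda>y. \<forall>w. \<not> parked_in y t w = Some (walks y v (Suc t)))"
      by (auto simp: ran_def fun_eq_iff)
    moreover have "Measurable.pred conf_space
        (\<lambda>y :: 'v conf. \<not> parked_in y t w = Some (walks y v (Suc t)))" for w
      by (intro pred_intros_logic pred_eq_countable[OF cnt Suc]
          measurable_compose[OF measurable_walks]) simp
    ultimately show ?thesis
      by (simp only:) (rule pred_ex_countable[OF countable_vertices])
  qed
  have [measurable]: "Measurable.pred conf_space (\<lambda>y :: 'v conf. \<forall>w. w \<noteq> v \<and> cars y w \<and>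
      parked_in y t w = None \<and> walks y w (Suc t) = walks y v (Suc t)
      \<longrightarrow> ties y v (Suc t) < ties y w (Suc t))"
  proof (rule pred_ex_countable[OF countable_vertices])
    fix w :: 'v
    have [measurable]: "Measurable.pred conf_space (\<lambda>y :: 'v conf. walks y w (Suc t) = walks y v (Suc t))"
      by (rule pred_eq_countable[OF countable_vertices]) measurable
    show "Measurable.pred conf_space (\<lambda>y :: 'v conf. w \<noteq> v \<and> cars y w \<and>
      parked_in y t w = None \<and> walks y w (Suc t) = walks y v (Suc t)
      \<longrightarrow> ties y v (Suc t) < ties y w (Suc t))"
      by measurable
  qed
  define Q where "Q = (\<lambda>y :: 'v conf. cars y v \<and> \<not> cars y (walks y v (Suc t)) \<and>
      walks y v (Suc t) \<notin> ran (parked_in y t) \<and>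
      (\<forall>w. w \<noteq> v \<and> cars y w \<and>
            parked_in y t w = None \<and> walks y w (Suc t) = walks y v (Suc t)
            \<longrightarrow> ties y v (Suc t) < ties y w (Suc t)))"
  have Q: "Measurable.pred conf_space Q" unfolding Q_def by measurable
  have none: "Measurable.pred conf_space (\<lambda>y :: 'v conf. parked_in y t v = None)" by measurable
  have new: "(\<lambda>y :: 'v conf. Some (walks y v (Suc t))) \<in> conf_space \<rightarrow>\<^sub>M count_space UNIV"
    by (intro measurable_compose[OF measurable_walks]) simp
  have "(\<lambda>y :: 'v conf. parked_in y (Suc t) v) = (\<lambda>y.
      if parked_in y t v = None then if Q y then Some (walks y v (Suc t)) else None
      else parked_in y t v)"
    by (auto simp: fun_eq_iff Q_def split: option.split)
  then show ?case
    using Q none by (simp only:) (intro measurable_If new Suc measurable_const, simp_all add: pred_def)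
qed simp

lemma pred_parked_in_eq [measurable]:
  "Measurable.pred conf_space (\<lambda>y :: 'v conf. parked_in y t v = z)"
  using measurable_parked_in by measurable

lemma pred_unparked_in [measurable]:
  "Measurable.pred conf_space (\<lambda>y :: 'v conf. unparked_in y t v)"
  unfolding unparked_def by measurable

lemma pred_occupied_in [measurable]:
  "Measurable.pred conf_space (\<lambda>y :: 'v conf. occupied_in y t x)"
  unfolding occupied_def by (rule pred_ex_countable[OF countable_vertices]) measurable

lemma pred_visited_io_in [measurable]:
  "Measurable.pred conf_space (\<lambda>y :: 'v conf. visited_io_in y x)"
  unfolding visited_io_def by measurable

lemma pred_spot_filled [measurable]:
  "Measurable.pred conf_space (\<lambda>y :: 'v conf. spot_filled (cars y) (walks y) (ties y) x)"
  unfolding spot_filled_def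
  by (intro pred_intros_countable pred_ex_countable[OF countable_vertices]) measurable

lemma pred_car_parks [measurable]:
  "Measurable.pred conf_space (\<lambda>y :: 'v conf. car_parks (cars y) (walks y) (ties y) v)"
  unfolding car_parks_def
  by (intro pred_intros_countable pred_ex_countable[OF countable_vertices]) measurable

end

section \<open>Relabelling the vertices\<close>

fun relabel_source :: "('v \<Rightarrow> 'v) \<Rightarrow> 'v source \<Rightarrow> 'v source" where
  "relabel_source \<phi> (Car v) = Car (\<phi> v)"
| "relabel_source \<phi> (Walk v) = Walk (\<phi> v)"
| "relabel_source \<phi> (Tie v t) = Tie (\<phi> v) t"

text \<open>
  The configuration as seen after renaming \<open>\<phi> v\<close> to \<open>v\<close>: sources are read off at the \<open>\<phi>\<close>-image,
  trajectories are pulled back by the inverse.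
\<close>

definition relabel :: "('v \<Rightarrow> 'v) \<Rightarrow> 'v conf \<Rightarrow> 'v conf" where
  "relabel \<phi> y = encode (\<lambda>v. cars y (\<phi> v)) (\<lambda>v t. inv_into UNIV \<phi> (walks y (\<phi> v) t)) (\<lambda>v. ties y (\<phi> v))"

fun relabel_outcome :: "('v \<Rightarrow> 'v) \<Rightarrow> 'v source \<Rightarrow> 'v outcome \<Rightarrow> 'v outcome" where
  "relabel_outcome \<phi> (Car v) z = (fst z, \<lambda>_. undefined, 0)"
| "relabel_outcome \<phi> (Walk v) z = (False, (\<lambda>t. inv_into UNIV \<phi> (fst (snd z) t)), 0)"
| "relabel_outcome \<phi> (Tie v t) z = (False, \<lambda>_. undefined, snd (snd z))"

lemma relabel_apply: "relabel \<phi> y s = relabel_outcome \<phi> s (y (relabel_source \<phi> s))"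
  by (cases s) (simp_all add: relabel_def cars_def walks_def ties_def fun_eq_iff)

lemma inj_relabel_source: "inj \<phi> \<Longrightarrow> inj (relabel_source \<phi>)"
  by (rule injI, rename_tac s s', case_tac s; case_tac s') (auto dest: injD)

lemma measurable_relabel_outcome [measurable]:
  fixes \<phi> :: "'v \<Rightarrow> 'v"
  shows "relabel_outcome \<phi> s \<in> outcome_space \<rightarrow>\<^sub>M outcome_space"
proof -
  have A: "(\<lambda>z. inv_into UNIV \<phi> (fst (snd z) t)) \<in> outcome_space \<rightarrow>\<^sub>M count_space UNIV" for t
  proof -
    have "(\<lambda>z. fst (snd z)) \<in> outcome_space \<rightarrow>\<^sub>M traj_space"
      unfolding outcome_space_def by measurable
    then have "(\<lambda>z. fst (snd z) t) \<in> outcome_space \<rightarrow>\<^sub>M count_space UNIV"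
      by (rule measurable_compose[OF _ measurable_traj_at])
    then show ?thesis
      by (rule measurable_compose) simp
  qed
  have B: "(\<lambda>z. fst z) \<in> outcome_space \<rightarrow>\<^sub>M count_space UNIV"
    "(\<lambda>z. snd (snd z)) \<in> outcome_space \<rightarrow>\<^sub>M borel"
    unfolding outcome_space_def by measurable
  consider "relabel_outcome \<phi> s = (\<lambda>z. (fst z, \<lambda>_. undefined, 0))"
    | "relabel_outcome \<phi> s = (\<lambda>z. (False, \<lambda>t. inv_into UNIV \<phi> (fst (snd z) t), 0))"
    | "relabel_outcome \<phi> s = (\<lambda>z. (False, \<lambda>_. undefined, snd (snd z)))"
    by (cases s) (simp_all add: fun_eq_iff)
  then show ?thesis
    unfolding outcome_space_def[where 'v = 'v, THEN arg_cong[where f = "measurable outcome_space"]]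
    by (cases; simp only:; intro measurable_Pair measurable_traj_spaceI A B measurable_const; simp)
qed

lemma measurable_relabel [measurable]: "relabel \<phi> \<in> conf_space \<rightarrow>\<^sub>M conf_space"
  unfolding relabel_def[abs_def]
  by (rule measurable_encode)
    (simp_all add: measurable_cars measurable_ties measurable_compose[OF measurable_walks])

lemma unparked_in_relabel:
  "bij \<phi> \<Longrightarrow> unparked_in (relabel \<phi> y) t v \<longleftrightarrow> unparked_in y t (\<phi> v)"
  by (simp add: relabel_def unparked_equivariant)

lemma visited_io_in_relabel:
  "bij \<phi> \<Longrightarrow> visited_io_in (relabel \<phi> y) x \<longleftrightarrow> visited_io_in y (\<phi> x)"
  by (simp add: relabel_def visited_io_equivariant)

section \<open>The law of the configuration\<close>

lemma pred_rectangle: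
  fixes h :: "'a \<Rightarrow> 'i \<Rightarrow> 'v"
  assumes "finite J" "\<And>t. (\<lambda>\<omega>. h \<omega> t) \<in> N \<rightarrow>\<^sub>M count_space UNIV"
  shows "Measurable.pred N (\<lambda>\<omega>. \<forall>i\<in>J. h \<omega> i \<in> A i)"
proof (rule pred_intros_finite(3)[OF assms(1)])
  fix i
  show "Measurable.pred N (\<lambda>\<omega>. h \<omega> i \<in> A i)"
    by (rule measurable_compose[OF assms(2)[of i], of "\<lambda>v. v \<in> A i"]) simp
qed

context prob_space
begin

lemma prob_eq_by_countable_partition:
  assumes D: "countable D"
    and R: "Measurable.pred M R" "\<And>z. z \<in> D \<Longrightarrow> Measurable.pred M (\<lambda>\<omega>. Z \<omega> = z)"
    and S: "Measurable.pred M S" "\<And>z. z \<in> D \<Longrightarrow> Measurable.pred M (\<lambda>\<omega>. Z' \<omega> = z)"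
    and RD: "\<And>\<omega>. \<omega> \<in> space M \<Longrightarrow> R \<omega> \<Longrightarrow> Z \<omega> \<in> D"
    and SD: "\<And>\<omega>. \<omega> \<in> space M \<Longrightarrow> S \<omega> \<Longrightarrow> Z' \<omega> \<in> D"
    and eq: "\<And>z. z \<in> D \<Longrightarrow> \<P>(\<omega> in M. R \<omega> \<and> Z \<omega> = z) = k * \<P>(\<omega> in M. S \<omega> \<and> Z' \<omega> = z)"
    and k: "0 \<le> k"
  shows "\<P>(\<omega> in M. R \<omega>) = k * \<P>(\<omega> in M. S \<omega>)"
proof -
  have split: "emeasure M {\<omega>\<in>space M. A \<omega>}
      = (\<integral>\<^sup>+ z. emeasure M {\<omega>\<in>space M. A \<omega> \<and> Y \<omega> = z} \<partial>count_space D)"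
    if A[measurable]: "Measurable.pred M A" and Y: "\<And>z. z \<in> D \<Longrightarrow> Measurable.pred M (\<lambda>\<omega>. Y \<omega> = z)"
      and AD: "\<And>\<omega>. \<omega> \<in> space M \<Longrightarrow> A \<omega> \<Longrightarrow> Y \<omega> \<in> D" for A Y
  proof -
    have "{\<omega>\<in>space M. A \<omega>} = (\<Union>z\<in>D. {\<omega>\<in>space M. A \<omega> \<and> Y \<omega> = z})"
      using AD by auto
    moreover have "{\<omega>\<in>space M. A \<omega> \<and> Y \<omega> = z} \<in> sets M" if "z \<in> D" for z
    proof -
      note Y[OF that, measurable]
      show ?thesis by measurable
    qed
    ultimately show ?thesis
      using D by (simp only:) (rule emeasure_UN_countable, auto simp: disjoint_family_on_def)
  qed
  have "ennreal \<P>(\<omega> in M. R \<omega>) = (\<integral>\<^sup>+ z. emeasure M {\<omega>\<in>space M. R \<omega> \<and> Z \<omega> = z} \<partial>count_space D)"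
    using split[of R Z] R RD by (simp add: emeasure_eq_measure)
  also have "\<dots> = (\<integral>\<^sup>+ z. ennreal k * emeasure M {\<omega>\<in>space M. S \<omega> \<and> Z' \<omega> = z} \<partial>count_space D)"
    by (intro nn_integral_cong) (simp add: emeasure_eq_measure eq ennreal_mult k)
  also have "\<dots> = ennreal k * ennreal \<P>(\<omega> in M. S \<omega>)"
    using split[of S Z'] S SD by (simp add: nn_integral_cmult emeasure_eq_measure)
  finally show ?thesis
    using k by (simp flip: ennreal_mult)
qed

text \<open>
  Up to time \<open>n\<close> there are only countably many trajectories, so their probabilities determine the
  finite-dimensional distributions.
\<close>

lemma traj_law_eqI:
  fixes f g :: "'a \<Rightarrow> nat \<Rightarrow> 'v"
  assumes cnt: "countable (UNIV :: 'v set)"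
    and f: "\<And>t. (\<lambda>\<omega>. f \<omega> t) \<in> M \<rightarrow>\<^sub>M count_space UNIV"
    and g: "\<And>t. (\<lambda>\<omega>. g \<omega> t) \<in> M \<rightarrow>\<^sub>M count_space UNIV"
    and eq: "\<And>n x. \<P>(\<omega> in M. \<forall>i\<le>n. f \<omega> i = x i) = \<P>(\<omega> in M. \<forall>i\<le>n. g \<omega> i = x i)"
  shows "distr M traj_space f = distr M traj_space g"
proof (rule measure_eqI_PiM_infinite[where I = UNIV and M = "\<lambda>_. count_space UNIV"])
  show "sets (distr M traj_space f) = sets (\<Pi>\<^sub>M t\<in>UNIV. count_space UNIV)"
    "sets (distr M traj_space g) = sets (\<Pi>\<^sub>M t\<in>UNIV. count_space UNIV)"
    by (simp_all add: traj_space_def)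
  show "finite_measure (distr M traj_space f)"
    by (intro prob_space.finite_measure prob_space_distr measurable_traj_spaceI f)
next
  fix A :: "nat \<Rightarrow> 'v set" and J :: "nat set"
  assume J: "finite J"
  then obtain n where n: "J \<subseteq> {..n}" using finite_nat_iff_bounded_le by blast
  define D where "D = PiE {..n} (\<lambda>i. if i \<in> J then A i else UNIV)"
  have D: "countable D"
    unfolding D_def by (rule countable_PiE) (auto intro: countable_subset[OF _ cnt])
  note [measurable] = f g
  have cyl: "{\<omega>\<in>space M. (\<forall>i\<in>J. h \<omega> i \<in> A i) \<and> restrict (h \<omega>) {..n} = z}
      = {\<omega>\<in>space M. \<forall>i\<le>n. h \<omega> i = z i}" if "z \<in> D" for h :: "'a \<Rightarrow> nat \<Rightarrow> 'v" and z
    using that n by (auto simp: D_def PiE_iff fun_eq_iff restrict_def extensional_def) (metis atMost_iff subsetD)+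
  have "\<P>(\<omega> in M. \<forall>i\<in>J. f \<omega> i \<in> A i) = 1 * \<P>(\<omega> in M. \<forall>i\<in>J. g \<omega> i \<in> A i)"
  proof (rule prob_eq_by_countable_partition[OF D, where Z = "\<lambda>\<omega>. restrict (f \<omega>) {..n}" and Z' = "\<lambda>\<omega>. restrict (g \<omega>) {..n}"])
    fix z assume z: "z \<in> D"
    have pz: "(restrict h {..n} = z) = (\<forall>i\<le>n. h i = z i)" for h
      using z by (auto simp: D_def PiE_iff fun_eq_iff restrict_def extensional_def)
    show "Measurable.pred M (\<lambda>\<omega>. restrict (f \<omega>) {..n} = z)"
      "Measurable.pred M (\<lambda>\<omega>. restrict (g \<omega>) {..n} = z)"
      unfolding pz by measurable
    show "\<P>(\<omega> in M. (\<forall>i\<in>J. f \<omega> i \<in> A i) \<and> restrict (f \<omega>) {..n} = z)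
        = 1 * \<P>(\<omega> in M. (\<forall>i\<in>J. g \<omega> i \<in> A i) \<and> restrict (g \<omega>) {..n} = z)"
      by (simp add: cyl[OF z] eq)
  next
    show "Measurable.pred M (\<lambda>\<omega>. \<forall>i\<in>J. f \<omega> i \<in> A i)" "Measurable.pred M (\<lambda>\<omega>. \<forall>i\<in>J. g \<omega> i \<in> A i)"
      by (rule pred_rectangle[OF J f] pred_rectangle[OF J g])+
  qed (use n in \<open>auto simp: D_def\<close>)
  then have "emeasure M {\<omega>\<in>space M. \<forall>i\<in>J. f \<omega> i \<in> A i} = emeasure M {\<omega>\<in>space M. \<forall>i\<in>J. g \<omega> i \<in> A i}"
    by (simp add: emeasure_eq_measure)
  moreover have "prod_emb UNIV (\<lambda>_. count_space UNIV) J (Pi\<^sub>E J A) = {x. \<forall>i\<in>J. x i \<in> A i}"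
    by (auto simp: prod_emb_def PiE_iff)
  moreover have "{x. \<forall>i\<in>J. x i \<in> A i} \<in> sets (traj_space :: (nat \<Rightarrow> 'v) measure)"
  proof -
    have "{x \<in> space traj_space. \<forall>i\<in>J. x i \<in> A i} \<in> sets (traj_space :: (nat \<Rightarrow> 'v) measure)"
      using pred_rectangle[OF J measurable_traj_at, where A = A] by (simp add: pred_def)
    then show ?thesis by simp
  qed
  ultimately show "emeasure (distr M traj_space f) (prod_emb UNIV (\<lambda>_. count_space UNIV) J (Pi\<^sub>E J A))
      = emeasure (distr M traj_space g) (prod_emb UNIV (\<lambda>_. count_space UNIV) J (Pi\<^sub>E J A))"
    by (simp add: emeasure_distr measurable_traj_spaceI f g vimage_def Int_def conj_commute)
qed

lemma indep_vars_reindex_inj: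
  assumes ind: "indep_vars N X UNIV" and f: "inj f"
  shows "indep_vars (\<lambda>i. N (f i)) (\<lambda>i. X (f i)) UNIV"
proof -
  let ?F = "\<lambda>i. {X i -` A \<inter> space M | A. A \<in> sets (N i)}"
  from ind have rv: "\<And>i. random_variable (N i) (X i)" and F: "indep_sets ?F UNIV"
    unfolding indep_vars_def2 by auto
  have "indep_sets (\<lambda>i. ?F (f i)) UNIV"
  proof (rule indep_setsI)
    show "?F (f i) \<subseteq> events" for i using rv by (auto intro: measurable_sets)
  next
    fix A J assume J: "J \<noteq> {}" "finite J" "\<forall>j\<in>J. A j \<in> ?F (f j)"
    define B where "B = (\<lambda>i. A (inv_into UNIV f i))"
    have B: "B (f j) = A j" for j using f by (simp add: B_def)
    have "prob (\<Inter>i\<in>f ` J. B i) = (\<Prod>i\<in>f ` J. prob (B i))"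
      using J by (intro indep_setsD[OF F]) (auto simp: B)
    also have "(\<Prod>i\<in>f ` J. prob (B i)) = (\<Prod>j\<in>J. prob (A j))"
      by (subst prod.reindex) (use f in \<open>auto simp: B inj_on_def\<close>)
    finally show "prob (\<Inter>j\<in>J. A j) = (\<Prod>j\<in>J. prob (A j))"
      by (simp add: B image_image)
  qed
  then show ?thesis unfolding indep_vars_def2 using rv by auto
qed

end

locale symmetric_parking =
  parking_process M K p car walk tie + vertex_group \<Gamma>
  for M :: "'w measure" and K :: "'v \<Rightarrow> 'v \<Rightarrow> real" and p :: real and car walk tie
    and \<Gamma> :: "('v \<Rightarrow> 'v) set" +
  assumes countable_vertices: "countable (UNIV :: 'v set)"
    and kernel_invariant: "\<phi> \<in> \<Gamma> \<Longrightarrow> K (\<phi> u) (\<phi> v) = K u v"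
    and kernel_nonneg: "0 \<le> K u v"
    and transitive: "transitive_triple \<Gamma>"
begin

definition conf :: "'w \<Rightarrow> 'v conf" where
  "conf \<omega> = encode (\<lambda>v. car v \<omega>) (\<lambda>v t. walk v t \<omega>) (\<lambda>v t. tie v t \<omega>)"

lemma conf_simps [simp]:
  "cars (conf \<omega>) v = car v \<omega>" "walks (conf \<omega>) v t = walk v t \<omega>" "ties (conf \<omega>) v t = tie v t \<omega>"
  by (simp_all add: conf_def)

declare car_measurable [measurable] walk_measurable [measurable] tie_measurable [measurable]

lemma measurable_conf [measurable]: "conf \<in> M \<rightarrow>\<^sub>M conf_space"
  unfolding conf_def[abs_def]
  by (rule measurable_encode) (rule car_measurable walk_measurable tie_measurable)+

lemmas pred_measurable [measurable] =
  pred_parked_in_eq[OF countable_vertices] pred_unparked_in[OF countable_vertices]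
  pred_occupied_in[OF countable_vertices] pred_visited_io_in[OF countable_vertices]
  pred_spot_filled[OF countable_vertices] pred_car_parks[OF countable_vertices]

lemma source_sets_subset:
  assumes f: "f \<in> space M \<rightarrow> space N" and h: "h \<in> N \<rightarrow>\<^sub>M outcome_space"
    and eq: "\<And>\<omega>. conf \<omega> s = h (f \<omega>)"
  shows "{(\<lambda>\<omega>. conf \<omega> s) -` A \<inter> space M | A. A \<in> sets outcome_space}
    \<subseteq> sets (vimage_algebra (space M) f N)"
proof -
  have "(\<lambda>\<omega>. conf \<omega> s) \<in> vimage_algebra (space M) f N \<rightarrow>\<^sub>M outcome_space"
    using measurable_compose[OF measurable_vimage_algebra1[OF f] h] by (simp add: eq)
  then show ?thesis
    by (auto dest!: measurable_sets)
qed

text \<open>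
  The value of \<open>conf\<close> at a source is a measurable function of the variable behind that source.
\<close>

lemma indep_sources: "indep_vars (\<lambda>_. outcome_space) (\<lambda>s \<omega>. conf \<omega> s) UNIV"
  unfolding indep_vars_def2
proof
  have "(\<lambda>\<omega>. conf \<omega> s) \<in> M \<rightarrow>\<^sub>M outcome_space" for s
    by (rule measurable_compose[OF measurable_conf measurable_source])
  then show "\<forall>s\<in>UNIV. (\<lambda>\<omega>. conf \<omega> s) \<in> M \<rightarrow>\<^sub>M outcome_space" by blast
  have "{(\<lambda>\<omega>. conf \<omega> s) -` A \<inter> space M | A. A \<in> sets outcome_space} \<subseteq> source_events M car walk tie s" for s
  proof (cases s)
    case (Car v)
    show ?thesis unfolding Car source_events.simps
      by (rule source_sets_subset[where h = "\<lambda>b. (b, \<lambda>_. undefined, 0)"])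
        (auto simp: outcome_space_def conf_def space_pair_measure intro!: measurable_Pair)
  next
    case (Walk v)
    show ?thesis unfolding Walk source_events.simps
      by (rule source_sets_subset[where h = "\<lambda>x. (False, x, 0)"])
        (auto simp: outcome_space_def conf_def traj_space_def space_PiM intro!: measurable_Pair)
  next
    case (Tie v t)
    show ?thesis unfolding Tie source_events.simps
      by (rule source_sets_subset[where h = "\<lambda>r. (False, \<lambda>_. undefined, r)"])
        (auto simp: outcome_space_def conf_def space_pair_measure intro!: measurable_Pair)
  qed
  then show "indep_sets (\<lambda>s. {(\<lambda>\<omega>. conf \<omega> s) -` A \<inter> space M | A. A \<in> sets outcome_space}) UNIV"
    by (intro indep_sets_mono_sets[OF independent]) auto
qed

lemma source_law_relabel:
  assumes \<phi>: "\<phi> \<in> \<Gamma>"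
  shows "distr M outcome_space (\<lambda>\<omega>. relabel \<phi> (conf \<omega>) s) = distr M outcome_space (\<lambda>\<omega>. conf \<omega> s)"
proof (cases s)
  case (Car v)
  define h :: "bool \<Rightarrow> 'v outcome" where "h = (\<lambda>b. (b, \<lambda>_. undefined, 0))"
  have h: "h \<in> count_space UNIV \<rightarrow>\<^sub>M outcome_space"
    by (auto simp: h_def outcome_space_def space_pair_measure intro!: measurable_Pair)
  have "distr M (count_space UNIV) (car (\<phi> v)) = distr M (count_space UNIV) (car v)"
  proof (rule measure_eqI_finite[where A = UNIV])
    fix b
    have np: "\<P>(\<omega> in M. \<not> car w \<omega>) = 1 - p" for w
      using prob_neg[of "car w"] car_law[of w] by simp
    have "\<P>(\<omega> in M. car (\<phi> v) \<omega> = b) = \<P>(\<omega> in M. car v \<omega> = b)"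
      by (cases b) (simp_all add: car_law np)
    then show "emeasure (distr M (count_space UNIV) (car (\<phi> v))) {b}
        = emeasure (distr M (count_space UNIV) (car v)) {b}"
      by (simp add: emeasure_distr emeasure_eq_measure vimage_def Int_def conj_commute)
  qed auto
  then have "distr (distr M (count_space UNIV) (car (\<phi> v))) outcome_space h
      = distr (distr M (count_space UNIV) (car v)) outcome_space h" by simp
  then show ?thesis
    using h by (simp add: Car distr_distr comp_def h_def relabel_def conf_def)
next
  case (Walk v)
  define h :: "(nat \<Rightarrow> 'v) \<Rightarrow> 'v outcome" where "h = (\<lambda>x. (False, x, 0))"
  have h: "h \<in> traj_space \<rightarrow>\<^sub>M outcome_space"
    by (auto simp: h_def outcome_space_def space_pair_measure intro!: measurable_Pair)
  have m: "(\<lambda>\<omega>. inv_into UNIV \<phi> (walk (\<phi> v) t \<omega>)) \<in> M \<rightarrow>\<^sub>M count_space UNIV" for t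
    by (rule measurable_compose[OF walk_measurable]) simp
  have "distr M traj_space (\<lambda>\<omega> t. inv_into UNIV \<phi> (walk (\<phi> v) t \<omega>)) = distr M traj_space (\<lambda>\<omega> t. walk v t \<omega>)"
  proof (rule traj_law_eqI[OF countable_vertices m walk_measurable])
    fix n and x :: "nat \<Rightarrow> 'v"
    show "\<P>(\<omega> in M. \<forall>i\<le>n. inv_into UNIV \<phi> (walk (\<phi> v) i \<omega>) = x i) = \<P>(\<omega> in M. \<forall>i\<le>n. walk v i \<omega> = x i)"
      using walk_law[where v = "\<phi> v" and n = n and x = "\<lambda>i. \<phi> (x i)"] 
        inv_eq_iff[OF \<phi>, of "\<phi> v" "x 0", symmetric]
      by (auto simp: inv_app[OF \<phi>] inv_eq_iff[OF \<phi>] walk_law kernel_invariant[OF \<phi>])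
  qed
  then have "distr (distr M traj_space (\<lambda>\<omega> t. inv_into UNIV \<phi> (walk (\<phi> v) t \<omega>))) outcome_space h
      = distr (distr M traj_space (\<lambda>\<omega> t. walk v t \<omega>)) outcome_space h" by simp
  then show ?thesis
    using h m by (simp add: Walk distr_distr comp_def h_def relabel_def conf_def measurable_traj_spaceI)
next
  case (Tie v t)
  define h :: "real \<Rightarrow> 'v outcome" where "h = (\<lambda>r. (False, \<lambda>_. undefined, r))"
  have h: "h \<in> borel \<rightarrow>\<^sub>M outcome_space"
    by (auto simp: h_def outcome_space_def space_pair_measure intro!: measurable_Pair)
  have "distr (distr M borel (tie (\<phi> v) t)) outcome_space h = distr (distr M borel (tie v t)) outcome_space h"
    by (simp add: tie_law)
  then show ?thesis
    using h by (simp add: Tie distr_distr comp_def h_def relabel_def conf_def)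
qed

text \<open>
  The original and the relabelled configuration both have independent coordinates, and the
  coordinate laws agree because \<open>p\<close> is the same at all vertices and \<open>K\<close> is invariant. So both
  have the same product measure as their law.
\<close>

lemma conf_law_relabel:
  assumes \<phi>: "\<phi> \<in> \<Gamma>"
  shows "distr M conf_space (\<lambda>\<omega>. relabel \<phi> (conf \<omega>)) = distr M conf_space conf"
proof -
  have rv: "(\<lambda>\<omega>. conf \<omega> s) \<in> M \<rightarrow>\<^sub>M outcome_space" for s
    by (rule measurable_compose[OF measurable_conf measurable_source])
  have rv': "(\<lambda>\<omega>. relabel \<phi> (conf \<omega>) s) \<in> M \<rightarrow>\<^sub>M outcome_space" for s
    by (rule measurable_compose[OF measurable_compose[OF measurable_conf measurable_relabel] measurable_source])
  have "indep_vars (\<lambda>_. outcome_space) (\<lambda>s \<omega>. conf \<omega> (relabel_source \<phi> s)) UNIV"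
    by (rule indep_vars_reindex_inj[OF indep_sources inj_relabel_source])
      (use bij_member[OF \<phi>] in \<open>simp add: bij_is_inj\<close>)
  then have "indep_vars (\<lambda>_. outcome_space) (\<lambda>s \<omega>. relabel_outcome \<phi> s (conf \<omega> (relabel_source \<phi> s))) UNIV"
    by (rule indep_vars_compose2) (rule measurable_relabel_outcome)
  then have "indep_vars (\<lambda>_. outcome_space) (\<lambda>s \<omega>. relabel \<phi> (conf \<omega>) s) UNIV"
    by (simp add: relabel_apply)
  then show ?thesis
    using indep_sources rv rv'
    by (simp add: indep_vars_iff_distr_eq_PiM source_law_relabel[OF \<phi>] restrict_UNIV flip: conf_space_def)
qed

lemma prob_relabel:
  assumes "\<phi> \<in> \<Gamma>" and [measurable]: "Measurable.pred conf_space Q"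
  shows "\<P>(\<omega> in M. Q (relabel \<phi> (conf \<omega>))) = \<P>(\<omega> in M. Q (conf \<omega>))"
proof -
  have "measure (distr M conf_space (\<lambda>\<omega>. relabel \<phi> (conf \<omega>))) {y\<in>space conf_space. Q y}
      = measure (distr M conf_space conf) {y\<in>space conf_space. Q y}"
    by (simp only: conf_law_relabel[OF assms(1)])
  moreover have "(\<lambda>\<omega>. relabel \<phi> (conf \<omega>)) \<in> M \<rightarrow>\<^sub>M conf_space" by measurable
  ultimately show ?thesis
    using assms(2) by (simp add: measure_distr vimage_def Int_def conj_commute pred_def)
qed

text \<open>
  With the trajectory of \<open>w\<close> overwritten by \<open>x\<close>, the event \<open>Q\<close> only depends on the other sources.
\<close>

lemma walk_independent_of_rest:
  assumes Q: "Measurable.pred conf_space Q"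
  shows "\<P>(\<omega> in M. Q ((conf \<omega>)(Walk w := (False, x, 0))) \<and> (\<forall>i\<le>n. walk w i \<omega> = x i))
    = \<P>(\<omega> in M. Q ((conf \<omega>)(Walk w := (False, x, 0)))) * \<P>(\<omega> in M. \<forall>i\<le>n. walk w i \<omega> = x i)"
proof -
  let ?N = "\<lambda>_. outcome_space :: 'v outcome measure"
  define e where "e = (\<lambda>(z :: 'v conf) s. if s = Walk w then (False, x, 0) else z s)"
  have e: "e \<in> PiM (- {Walk w}) ?N \<rightarrow>\<^sub>M conf_space"
    unfolding conf_space_def e_def[abs_def]
  proof (rule measurable_PiM_single')
    fix s
    show "(\<lambda>z. if s = Walk w then (False, x, 0) else z s) \<in> PiM (- {Walk w}) ?N \<rightarrow>\<^sub>M outcome_space"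
      by (cases "s = Walk w") (auto intro!: measurable_component_singleton)
  qed auto
  define A where "A = {z\<in>space (PiM (- {Walk w}) ?N). Q (e z)}"
  have A: "A \<in> sets (PiM (- {Walk w}) ?N)"
    using measurable_compose[OF e Q] by (simp add: A_def pred_def)
  define B where "B = {z\<in>space (PiM {Walk w} ?N). \<forall>i\<le>n. fst (snd (z (Walk w))) i = x i}"
  have "(\<lambda>z. fst (snd (z (Walk w))) i) \<in> PiM {Walk w} ?N \<rightarrow>\<^sub>M count_space UNIV" for i
  proof -
    have "(\<lambda>z. z (Walk w)) \<in> PiM {Walk w} ?N \<rightarrow>\<^sub>M outcome_space"
      by (intro measurable_component_singleton) simp
    moreover have "(\<lambda>z. fst (snd z)) \<in> outcome_space \<rightarrow>\<^sub>M traj_space"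
      unfolding outcome_space_def by measurable
    ultimately show ?thesis
      by (intro measurable_compose[OF _ measurable_traj_at]) (rule measurable_compose)
  qed
  note this[measurable]
  have B: "B \<in> sets (PiM {Walk w} ?N)"
    unfolding B_def by measurable
  have rest: "restrict (conf \<omega>) S \<in> space (PiM S ?N)" for \<omega> S
    by (simp add: space_PiM)
  have val: "fst (snd (conf \<omega> (Walk w))) i = walk w i \<omega>" for \<omega> i
    by (simp add: conf_def)
  have eq: "e (restrict (conf \<omega>) (- {Walk w})) = (conf \<omega>)(Walk w := (False, x, 0))" for \<omega>
    by (auto simp: e_def fun_eq_iff)
  have "indep_var (PiM (- {Walk w}) ?N) (\<lambda>\<omega>. restrict (\<lambda>s. conf \<omega> s) (- {Walk w}))
      (PiM {Walk w} ?N) (\<lambda>\<omega>. restrict (\<lambda>s. conf \<omega> s) {Walk w})"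
    by (rule indep_var_restrict[OF indep_sources]) auto
  from indep_varD[OF this A B]
  show ?thesis
    using rest by (simp add: A_def B_def eq val vimage_def Int_def conj_commute)
qed

text \<open>
  What is known at time \<open>t\<close> includes the tie-breaking values of later times: they are independent of
  the walks, so that the next step of a walk is still governed by \<open>K\<close>.
\<close>

definition known_at :: "nat \<Rightarrow> ('v conf \<Rightarrow> bool) \<Rightarrow> bool" where
  "known_at t Q \<longleftrightarrow> (\<forall>y y'. cars y = cars y' \<longrightarrow> ties y = ties y' \<longrightarrow>
      (\<forall>v. \<forall>i\<le>t. walks y v i = walks y' v i) \<longrightarrow> Q y = Q y')"

text \<open>
  On each of the countably many trajectories of \<open>w\<close> up to time \<open>t\<close>, overwrite the walk of \<open>w\<close> by
  that trajectory; then \<open>Q\<close> becomes independent of the walk of \<open>w\<close>, whose law is a product of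
  kernel values.
\<close>

lemma markov_step:
  assumes Q[measurable]: "Measurable.pred conf_space Q" and known: "known_at t Q"
  shows "\<P>(\<omega> in M. (Q (conf \<omega>) \<and> walk w t \<omega> = a) \<and> walk w (Suc t) \<omega> = b)
    = K a b * \<P>(\<omega> in M. Q (conf \<omega>) \<and> walk w t \<omega> = a)"
proof (rule prob_eq_by_countable_partition[where D = "PiE {..t} (\<lambda>_. UNIV)"
      and Z = "\<lambda>\<omega>. restrict (\<lambda>i. walk w i \<omega>) {..t}" and Z' = "\<lambda>\<omega>. restrict (\<lambda>i. walk w i \<omega>) {..t}"])
  show "countable (PiE {..t} (\<lambda>_. UNIV :: 'v set))"
    by (intro countable_PiE countable_vertices) auto
  show "Measurable.pred M (\<lambda>\<omega>. (Q (conf \<omega>) \<and> walk w t \<omega> = a) \<and> walk w (Suc t) \<omega> = b)"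
    "Measurable.pred M (\<lambda>\<omega>. Q (conf \<omega>) \<and> walk w t \<omega> = a)"
    by measurable
  fix z :: "nat \<Rightarrow> 'v" assume z: "z \<in> PiE {..t} (\<lambda>_. UNIV)"
  have pz: "(restrict h {..t} = z) = (\<forall>i\<le>t. h i = z i)" for h
    using z by (auto simp: PiE_iff fun_eq_iff restrict_def extensional_def)
  show "Measurable.pred M (\<lambda>\<omega>. restrict (\<lambda>i. walk w i \<omega>) {..t} = z)"
    "Measurable.pred M (\<lambda>\<omega>. restrict (\<lambda>i. walk w i \<omega>) {..t} = z)"
    unfolding pz by measurable
  show "\<P>(\<omega> in M. ((Q (conf \<omega>) \<and> walk w t \<omega> = a) \<and> walk w (Suc t) \<omega> = b) \<and>
        restrict (\<lambda>i. walk w i \<omega>) {..t} = z)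
      = K a b * \<P>(\<omega> in M. (Q (conf \<omega>) \<and> walk w t \<omega> = a) \<and> restrict (\<lambda>i. walk w i \<omega>) {..t} = z)"
  proof (cases "z t = a")
    case True
    \<comment> \<open>One trajectory serves for the events up to time \<open>t\<close> and up to time \<open>Suc t\<close>.\<close>
    define x where "x = z(Suc t := b)"
    let ?o = "\<lambda>\<omega>. (conf \<omega>)(Walk w := (False, x, 0))"
    have Q_eq: "Q (conf \<omega>) = Q (?o \<omega>)" if "\<forall>i\<le>t. walk w i \<omega> = x i" for \<omega>
    proof -
      have "cars (conf \<omega>) = cars (?o \<omega>)" "ties (conf \<omega>) = ties (?o \<omega>)"
        by (auto simp: cars_def ties_def fun_eq_iff)
      moreover have "walks (conf \<omega>) v i = walks (?o \<omega>) v i" if "i \<le> t" for v i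
        using \<open>\<forall>i\<le>t. walk w i \<omega> = x i\<close> that conf_simps(2)[of \<omega> v i] by (auto simp: walks_def)
      ultimately show ?thesis using known unfolding known_at_def by blast
    qed
    have short: "(\<forall>i\<le>t. walk w i \<omega> = z i) = (\<forall>i\<le>t. walk w i \<omega> = x i)" for \<omega>
      by (auto simp: x_def)
    have E1: "(((Q (conf \<omega>) \<and> walk w t \<omega> = a) \<and> walk w (Suc t) \<omega> = b) \<and> (\<forall>i\<le>t. walk w i \<omega> = z i))
        = (Q (?o \<omega>) \<and> (\<forall>i\<le>Suc t. walk w i \<omega> = x i))" for \<omega>
      unfolding short using Q_eq[of \<omega>] True
      by (auto simp: le_Suc_eq x_def)
    have E2: "((Q (conf \<omega>) \<and> walk w t \<omega> = a) \<and> (\<forall>i\<le>t. walk w i \<omega> = z i))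
        = (Q (?o \<omega>) \<and> (\<forall>i\<le>t. walk w i \<omega> = x i))" for \<omega>
      unfolding short using Q_eq[of \<omega>] True by (auto simp: x_def)
    have xt: "x t = a" "x (Suc t) = b" using True by (simp_all add: x_def)
    show ?thesis
      unfolding pz E1 E2 walk_independent_of_rest[OF Q] walk_law
      by (simp add: xt)
  next
    case False
    then have F: "(((Q (conf \<omega>) \<and> walk w t \<omega> = a) \<and> walk w (Suc t) \<omega> = b) \<and> (\<forall>i\<le>t. walk w i \<omega> = z i)) = False"
      "((Q (conf \<omega>) \<and> walk w t \<omega> = a) \<and> (\<forall>i\<le>t. walk w i \<omega> = z i)) = False" for \<omega>
      by auto
    show ?thesis unfolding pz F by simp
  qed
qed (auto simp: kernel_nonneg)

end

section \<open>Recurrent visits spread along the kernel\<close>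

context symmetric_parking
begin

text \<open>
  Among the unparked cars at \<open>a\<close> one is singled out by an enumeration of the vertices. It is
  determined by the information of time \<open>t\<close>, so that a visit is followed by a \<open>crossing\<close> to \<open>b\<close>
  with probability exactly \<open>K a b\<close>.
\<close>

definition first_visitor :: "'v conf \<Rightarrow> nat \<Rightarrow> 'v \<Rightarrow> 'v \<Rightarrow> bool" where
  "first_visitor y t a w \<longleftrightarrow> unparked_in y t w \<and> walks y w t = a \<and>
     (\<forall>w'. to_nat_on UNIV w' < to_nat_on UNIV w \<longrightarrow> \<not> (unparked_in y t w' \<and> walks y w' t = a))"

definition crossing :: "'v conf \<Rightarrow> nat \<Rightarrow> 'v \<Rightarrow> 'v \<Rightarrow> bool" where
  "crossing y t a b \<longleftrightarrow> (\<exists>w. first_visitor y t a w \<and> walks y w (Suc t) = b)"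

definition no_crossing :: "'v conf \<Rightarrow> nat \<Rightarrow> nat \<Rightarrow> 'v \<Rightarrow> 'v \<Rightarrow> bool" where
  "no_crossing y m t a b \<longleftrightarrow> (\<forall>s\<in>{m..<t}. \<not> crossing y s a b)"

lemma enum_inj: "to_nat_on UNIV (v :: 'v) = to_nat_on UNIV w \<longleftrightarrow> v = w"
  using inj_on_to_nat_on[OF countable_vertices] by (auto simp: inj_on_def)

lemma first_visitor_unique: "first_visitor y t a v \<Longrightarrow> first_visitor y t a w \<Longrightarrow> v = w"
  unfolding first_visitor_def using enum_inj[of v w] by (metis linorder_neqE_nat)

lemma first_visitor_ex: "occupied_in y t a \<longleftrightarrow> (\<exists>w. first_visitor y t a w)"
proof
  assume "occupied_in y t a"
  then obtain w where w: "unparked_in y t w \<and> walks y w t = a"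
    by (auto simp: occupied_def)
  have "\<exists>w. (unparked_in y t w \<and> walks y w t = a) \<and>
      (\<forall>w'. to_nat_on UNIV w' < to_nat_on UNIV w \<longrightarrow> \<not> (unparked_in y t w' \<and> walks y w' t = a))"
    using ex_has_least_nat[of "\<lambda>w. unparked_in y t w \<and> walks y w t = a" w "to_nat_on UNIV", OF w]
    by (auto simp: not_less[symmetric])
  then show "\<exists>w. first_visitor y t a w" by (simp add: first_visitor_def conj_assoc)
qed (auto simp: first_visitor_def occupied_def)

lemma pred_first_visitor [measurable]:
  "Measurable.pred conf_space (\<lambda>y. first_visitor y t a w)"
  unfolding first_visitor_def
  by (intro pred_intros_logic pred_ex_countable(2)[OF countable_vertices]) measurable

lemma pred_crossing [measurable]: "Measurable.pred conf_space (\<lambda>y. crossing y t a b)"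
  unfolding crossing_def
  by (intro pred_ex_countable(1)[OF countable_vertices]) measurable

lemma pred_no_crossing [measurable]: "Measurable.pred conf_space (\<lambda>y. no_crossing y m t a b)"
  unfolding no_crossing_def by measurable

lemma unparked_in_cong:
  assumes "cars y = cars y'" "ties y = ties y'" "\<And>v i. i \<le> t \<Longrightarrow> walks y v i = walks y' v i"
  shows "unparked_in y t w = unparked_in y' t w"
  using parked_at_cong[of t "walks y" "walks y'" "cars y'" "ties y'"] assms
  by (simp add: unparked_def)

lemma first_visitor_cong:
  assumes "cars y = cars y'" "ties y = ties y'" "\<And>v i. i \<le> t \<Longrightarrow> walks y v i = walks y' v i"
  shows "first_visitor y t a w = first_visitor y' t a w"
  using unparked_in_cong[OF assms] assms(3)[of t] by (simp add: first_visitor_def)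

lemma no_crossing_cong:
  assumes "cars y = cars y'" "ties y = ties y'" "\<And>v i. i \<le> t \<Longrightarrow> walks y v i = walks y' v i"
  shows "no_crossing y m t a b = no_crossing y' m t a b"
proof -
  have "crossing y s a b = crossing y' s a b" if "s < t" for s
    using first_visitor_cong[OF assms(1,2), of s a] assms(3) that
    by (simp add: crossing_def)
  then show ?thesis by (simp add: no_crossing_def)
qed

lemma prob_crossing:
  "\<P>(\<omega> in M. no_crossing (conf \<omega>) m t a b \<and> crossing (conf \<omega>) t a b)
    = K a b * \<P>(\<omega> in M. no_crossing (conf \<omega>) m t a b \<and> occupied_in (conf \<omega>) t a)"
proof -
  \<comment> \<open>Split both events according to the first visitor, if there is one.\<close>
  define Z where "Z = (\<lambda>\<omega>. if occupied_in (conf \<omega>) t a then Some (THE w. first_visitor (conf \<omega>) t a w) else None)"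
  have Z: "Z \<omega> = Some w \<longleftrightarrow> first_visitor (conf \<omega>) t a w" for \<omega> w
    using first_visitor_ex[of "conf \<omega>" t a] first_visitor_unique[of "conf \<omega>" t a]
    by (auto simp: Z_def intro: the_equality theI)
  show ?thesis
  proof (rule prob_eq_by_countable_partition[where D = "range Some" and Z = Z and Z' = Z])
    show "countable (range Some :: 'v option set)" by (intro countable_image countable_vertices)
    show "Measurable.pred M (\<lambda>\<omega>. no_crossing (conf \<omega>) m t a b \<and> crossing (conf \<omega>) t a b)"
      "Measurable.pred M (\<lambda>\<omega>. no_crossing (conf \<omega>) m t a b \<and> occupied_in (conf \<omega>) t a)"
      by measurable
    fix z :: "'v option" assume "z \<in> range Some"
    then obtain w where z: "z = Some w" by blast
    show "Measurable.pred M (\<lambda>\<omega>. Z \<omega> = z)" "Measurable.pred M (\<lambda>\<omega>. Z \<omega> = z)"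
      unfolding z Z by measurable
    define Q where "Q = (\<lambda>y. no_crossing y m t a b \<and> first_visitor y t a w)"
    have "known_at t Q"
      unfolding known_at_def Q_def
      by (intro allI impI conj_cong no_crossing_cong first_visitor_cong) auto
    moreover have "Measurable.pred conf_space Q" unfolding Q_def by measurable
    ultimately have eq: "\<P>(\<omega> in M. (Q (conf \<omega>) \<and> walk w t \<omega> = a) \<and> walk w (Suc t) \<omega> = b)
        = K a b * \<P>(\<omega> in M. Q (conf \<omega>) \<and> walk w t \<omega> = a)"
      by (intro markov_step)
    have "((no_crossing (conf \<omega>) m t a b \<and> crossing (conf \<omega>) t a b) \<and> Z \<omega> = z)
        = ((Q (conf \<omega>) \<and> walk w t \<omega> = a) \<and> walk w (Suc t) \<omega> = b)" for \<omega>
      unfolding z Z using first_visitor_unique[of "conf \<omega>" t a w]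
      by (auto simp: crossing_def Q_def first_visitor_def)
    moreover have "((no_crossing (conf \<omega>) m t a b \<and> occupied_in (conf \<omega>) t a) \<and> Z \<omega> = z)
        = (Q (conf \<omega>) \<and> walk w t \<omega> = a)" for \<omega>
      unfolding z Z using first_visitor_ex[of "conf \<omega>" t a]
      by (auto simp: Q_def first_visitor_def)
    ultimately show "\<P>(\<omega> in M. (no_crossing (conf \<omega>) m t a b \<and> crossing (conf \<omega>) t a b) \<and> Z \<omega> = z)
      = K a b * \<P>(\<omega> in M. (no_crossing (conf \<omega>) m t a b \<and> occupied_in (conf \<omega>) t a) \<and> Z \<omega> = z)"
      using eq by simp
  next
    fix \<omega>
    show "no_crossing (conf \<omega>) m t a b \<and> crossing (conf \<omega>) t a b \<Longrightarrow> Z \<omega> \<in> range Some"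
      "no_crossing (conf \<omega>) m t a b \<and> occupied_in (conf \<omega>) t a \<Longrightarrow> Z \<omega> \<in> range Some"
      using first_visitor_ex[of "conf \<omega>" t a] by (auto simp: Z_def crossing_def)
  qed (rule kernel_nonneg)
qed

text \<open>
  The events that the first crossing from time \<open>m\<close> on happens at time \<open>t\<close> are disjoint in \<open>t\<close>, so
  their probabilities are summable. By \<open>prob_crossing\<close> they are \<open>K a b\<close> times the probabilities
  that \<open>a\<close> is visited at time \<open>t\<close> without a crossing since \<open>m\<close>, and Borel-Cantelli applies to
  the latter.
\<close>

lemma AE_no_crossing_finitely_occupied:
  assumes pos: "K a b > 0"
  shows "AE \<omega> in M. \<forall>\<^sub>F t in sequentially. \<not> (no_crossing (conf \<omega>) m t a b \<and> occupied_in (conf \<omega>) t a)"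
proof -
  define G where "G = (\<lambda>t. {\<omega>\<in>space M. m \<le> t \<and> no_crossing (conf \<omega>) m t a b \<and> crossing (conf \<omega>) t a b})"
  define B where "B = (\<lambda>t. {\<omega>\<in>space M. m \<le> t \<and> no_crossing (conf \<omega>) m t a b \<and> occupied_in (conf \<omega>) t a})"
  have G: "G t \<in> events" and B: "B t \<in> events" for t
    unfolding G_def B_def by measurable
  have "disjoint_family G"
    unfolding disjoint_family_on_def
  proof (intro ballI impI)
    have "G s \<inter> G t = {}" if "s < t" for s t
      using that by (force simp: G_def no_crossing_def)
    then show "G s \<inter> G t = {}" if "s \<noteq> t" for s t
      using that by (metis Int_commute linorder_neqE_nat)
  qed
  then have "summable (\<lambda>t. prob (G t))"
    using G by (intro sums_summable[OF finite_measure_UNION]) auto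
  moreover have "prob (B t) = prob (G t) / K a b" for t
    using prob_crossing[of m t a b] pos by (cases "m \<le> t") (simp_all add: G_def B_def)
  ultimately have "summable (\<lambda>t. prob (B t))"
    by (simp add: summable_divide)
  then have "AE \<omega> in M. \<forall>\<^sub>F t in sequentially. \<omega> \<in> space M - B t"
    using B by (intro borel_cantelli_AE1) (auto simp: emeasure_eq_measure)
  then show ?thesis
  proof (rule AE_mp, intro AE_I2 impI)
    fix \<omega> assume "\<omega> \<in> space M"
    assume "\<forall>\<^sub>F t in sequentially. \<omega> \<in> space M - B t"
    with eventually_ge_at_top[of m]
    show "\<forall>\<^sub>F t in sequentially. \<not> (no_crossing (conf \<omega>) m t a b \<and> occupied_in (conf \<omega>) t a)"
      by eventually_elim (auto simp: B_def)
  qed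
qed

lemma AE_visited_io_neighbour:
  assumes pos: "K a b > 0"
  shows "AE \<omega> in M. visited_io_in (conf \<omega>) a \<longrightarrow> visited_io_in (conf \<omega>) b"
proof -
  have "AE \<omega> in M. \<forall>m. \<forall>\<^sub>F t in sequentially. \<not> (no_crossing (conf \<omega>) m t a b \<and> occupied_in (conf \<omega>) t a)"
    unfolding AE_all_countable using AE_no_crossing_finitely_occupied[OF pos] by blast
  then show ?thesis
  proof (rule AE_mp, intro AE_I2 impI)
    fix \<omega> assume fin: "\<forall>m. \<forall>\<^sub>F t in sequentially. \<not> (no_crossing (conf \<omega>) m t a b \<and> occupied_in (conf \<omega>) t a)"
      and io: "visited_io_in (conf \<omega>) a"
    have "\<exists>t\<ge>n. crossing (conf \<omega>) t a b" for n
    proof (rule ccontr)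
      assume "\<not> (\<exists>t\<ge>n. crossing (conf \<omega>) t a b)"
      then have "no_crossing (conf \<omega>) n t a b" for t by (auto simp: no_crossing_def)
      with fin obtain N where "\<And>t. t \<ge> N \<Longrightarrow> \<not> occupied_in (conf \<omega>) t a"
        unfolding eventually_sequentially by blast
      with io show False by (auto simp: visited_io_def)
    qed
    then show "visited_io_in (conf \<omega>) b"
      by (intro visited_io_step) (auto simp: crossing_def first_visitor_def, metis)
  qed
qed

lemma AE_visited_io_accessible:
  assumes "accessible_from E K b a"
  shows "AE \<omega> in M. visited_io_in (conf \<omega>) a \<longrightarrow> visited_io_in (conf \<omega>) b"
proof -
  obtain n x where x: "x 0 = a" "x n = b" "(\<Prod>i<n. K (x i) (x (Suc i))) > 0"
    using assms by (auto simp: accessible_from_def)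
  have pos: "K (x i) (x (Suc i)) > 0" if "i < n" for i
    using x(3) that kernel_nonneg[of "x i" "x (Suc i)"]
    by (metis finite_lessThan lessThan_iff less_eq_real_def prod_zero)
  have "AE \<omega> in M. visited_io_in (conf \<omega>) (x 0) \<longrightarrow> visited_io_in (conf \<omega>) (x i)" if "i \<le> n" for i
    using that
  proof (induction i)
    case (Suc i)
    from Suc.IH[OF Suc_leD[OF Suc.prems]] AE_visited_io_neighbour[OF pos[OF Suc_le_lessD[OF Suc.prems]]]
    show ?case by eventually_elim blast
  qed simp
  from this[of n] show ?thesis by (simp add: x)
qed

end

section \<open>A zero-one law for displaced events\<close>

definition cylinder :: "'v source set \<Rightarrow> 'v conf set \<Rightarrow> 'v conf set" where
  "cylinder J X = {y. restrict y J \<in> X}"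

definition cylinders :: "'v conf set set" where
  "cylinders = {cylinder J X | J X. finite J \<and> X \<in> sets (\<Pi>\<^sub>M s\<in>J. outcome_space)}"

lemma cylindersI: "finite J \<Longrightarrow> X \<in> sets (\<Pi>\<^sub>M s\<in>J. outcome_space) \<Longrightarrow> cylinder J X \<in> cylinders"
  unfolding cylinders_def by blast

lemma measurable_restrict_conf [measurable]:
  "(\<lambda>y. restrict y J) \<in> conf_space \<rightarrow>\<^sub>M (\<Pi>\<^sub>M s\<in>J. outcome_space)"
  unfolding conf_space_def by (rule measurable_restrict_subset) simp

lemma sets_cylinder: "X \<in> sets (\<Pi>\<^sub>M s\<in>J. outcome_space) \<Longrightarrow> cylinder J X \<in> sets conf_space"
  using measurable_sets[OF measurable_restrict_conf, of X J] by (simp add: cylinder_def vimage_def)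

lemma sets_cylinders: "C \<in> cylinders \<Longrightarrow> C \<in> sets conf_space"
  by (auto simp: cylinders_def sets_cylinder)

lemma cylinder_extend:
  assumes "J \<subseteq> L" "X \<in> sets (\<Pi>\<^sub>M s\<in>J. outcome_space)"
  shows "\<exists>Y\<in>sets (\<Pi>\<^sub>M s\<in>L. outcome_space). cylinder J X = cylinder L Y"
proof
  have "(\<lambda>z. restrict z J) \<in> (\<Pi>\<^sub>M s\<in>L. outcome_space) \<rightarrow>\<^sub>M (\<Pi>\<^sub>M s\<in>J. outcome_space)"
    using assms(1) by (rule measurable_restrict_subset)
  from measurable_sets[OF this assms(2)]
  show "(\<lambda>z. restrict z J) -` X \<inter> space (\<Pi>\<^sub>M s\<in>L. outcome_space) \<in> sets (\<Pi>\<^sub>M s\<in>L. outcome_space)" .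
  have "L \<inter> J = J" using assms(1) by blast
  then show "cylinder J X = cylinder L ((\<lambda>z. restrict z J) -` X \<inter> space (\<Pi>\<^sub>M s\<in>L. outcome_space))"
    using assms(1) by (auto simp: cylinder_def space_PiM)
qed

lemma cylinders_Un:
  assumes "C \<in> cylinders" "D \<in> cylinders"
  shows "C \<union> D \<in> cylinders"
proof -
  obtain J X L Y where C: "finite J" "X \<in> sets (\<Pi>\<^sub>M s\<in>J. outcome_space)" "C = cylinder J X"
    and D: "finite L" "Y \<in> sets (\<Pi>\<^sub>M s\<in>L. outcome_space)" "D = cylinder L Y"
    using assms by (auto simp: cylinders_def)
  obtain X' Y' where "X' \<in> sets (\<Pi>\<^sub>M s\<in>J \<union> L. outcome_space)" "C = cylinder (J \<union> L) X'"
    "Y' \<in> sets (\<Pi>\<^sub>M s\<in>J \<union> L. outcome_space)" "D = cylinder (J \<union> L) Y'"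
    using cylinder_extend[OF _ C(2), of "J \<union> L"] cylinder_extend[OF _ D(2), of "J \<union> L"] C(3) D(3)
    by auto
  moreover from this have "C \<union> D = cylinder (J \<union> L) (X' \<union> Y')"
    by (auto simp: cylinder_def)
  ultimately show ?thesis using C(1) D(1) by (auto intro!: cylindersI)
qed

lemma cylinders_empty: "{} \<in> cylinders"
  using cylindersI[of "{}" "{}"] by (simp add: cylinder_def)

lemma cylinders_UN: "finite I \<Longrightarrow> (\<And>i. i \<in> I \<Longrightarrow> C i \<in> cylinders) \<Longrightarrow> (\<Union>i\<in>I. C i) \<in> cylinders"
  by (induction I rule: finite_induct) (auto intro: cylinders_empty cylinders_Un)

lemma cylinders_Compl:
  assumes "C \<in> cylinders" shows "UNIV - C \<in> cylinders"
proof -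
  obtain J X where C: "finite J" "X \<in> sets (\<Pi>\<^sub>M s\<in>J. outcome_space)" "C = cylinder J X"
    using assms by (auto simp: cylinders_def)
  have "UNIV - C = cylinder J (space (\<Pi>\<^sub>M s\<in>J. outcome_space) - X)"
    by (auto simp: C(3) cylinder_def space_PiM)
  then show ?thesis using C by (auto intro!: cylindersI)
qed

text \<open>
  The sets that can be approximated by cylinders form a sigma-algebra: for a countable union,
  approximate the members of a finite subunion that has almost all the mass.
\<close>

lemma cylinder_approximation:
  fixes L :: "'v conf measure"
  assumes L: "prob_space L" and sets_L: "sets L = sets conf_space"
    and A: "A \<in> sets conf_space" and \<epsilon>: "0 < \<epsilon>"
  shows "\<exists>C\<in>cylinders. measure L ((A - C) \<union> (C - A)) < \<epsilon>"
proof -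
  interpret L: prob_space L by (rule L)
  let ?S = "{{f \<in> UNIV. f i \<in> A} | i A. i \<in> UNIV \<and> A \<in> sets outcome_space} :: 'v conf set set"
  have sig: "sets (conf_space :: 'v conf measure) = sigma_sets UNIV ?S"
    unfolding conf_space_def sets_PiM_single by simp
  have cyl_L: "C \<in> L.events" if "C \<in> cylinders" for C
    using sets_cylinders[OF that] sets_L by simp
  from A[unfolded sig] show ?thesis
    using \<epsilon>
  proof (induction arbitrary: \<epsilon> rule: sigma_sets.induct)
    case (Basic B)
    then obtain s A where A: "B = {f. f s \<in> A}" "A \<in> sets outcome_space" by auto
    have "(\<lambda>z. z s) \<in> (\<Pi>\<^sub>M s\<in>{s}. outcome_space) \<rightarrow>\<^sub>M outcome_space"
      by (rule measurable_component_singleton) simp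
    from measurable_sets[OF this A(2)]
    have "cylinder {s} ((\<lambda>z. z s) -` A \<inter> space (\<Pi>\<^sub>M s\<in>{s}. outcome_space)) \<in> cylinders"
      by (intro cylindersI) auto
    also have "cylinder {s} ((\<lambda>z. z s) -` A \<inter> space (\<Pi>\<^sub>M s\<in>{s}. outcome_space)) = B"
      by (auto simp: cylinder_def A(1) space_PiM)
    finally show ?case using Basic by (intro bexI[of _ B]) auto
  next
    case Empty
    then show ?case by (intro bexI[of _ "{}"] cylinders_empty) auto
  next
    case (Compl B)
    then obtain C where C: "C \<in> cylinders" "measure L ((B - C) \<union> (C - B)) < \<epsilon>" by blast
    have "(UNIV - B - (UNIV - C)) \<union> (UNIV - C - (UNIV - B)) = (B - C) \<union> (C - B)" by auto
    then show ?case using C cylinders_Compl[OF C(1)] by (intro bexI[of _ "UNIV - C"]) auto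
  next
    case (Union B)
    have B: "B i \<in> L.events" for i
      using Union.hyps sig sets_L by auto
    define B' where "B' = (\<lambda>k. \<Union>i<k. B i)"
    have B': "B' k \<in> L.events" for k using B by (auto simp: B'_def)
    have "(\<lambda>k. measure L (B' k)) \<longlonglongrightarrow> measure L (\<Union>k. B' k)"
      by (rule L.finite_Lim_measure_incseq) (use B' in \<open>fastforce simp: incseq_def B'_def\<close>)+
    moreover have "(\<Union>k. B' k) = \<Union> (range B)" by (auto simp: B'_def)
    ultimately have "(\<lambda>k. measure L (B' k)) \<longlonglongrightarrow> measure L (\<Union> (range B))" by simp
    then have "\<forall>\<^sub>F k in sequentially. measure L (\<Union> (range B)) - \<epsilon> / 2 < measure L (B' k)"
      by (rule order_tendstoD(1)) (use Union.prems in simp)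
    then obtain k where k: "measure L (\<Union> (range B)) - \<epsilon> / 2 < measure L (B' k)"
      by (auto simp: eventually_sequentially)
    have tail: "measure L (\<Union> (range B) - B' k) < \<epsilon> / 2"
      using k B B' by (subst L.finite_measure_Diff) (auto simp: B'_def)
    \<comment> \<open>The errors of \<open>k\<close> approximations have to add up to at most \<open>\<epsilon> / 2\<close>, also for \<open>k = 0\<close>.\<close>
    define \<delta> where "\<delta> = \<epsilon> / (2 * (real k + 1))"
    have "0 < \<delta>" using Union.prems by (simp add: \<delta>_def)
    then have "\<forall>i. \<exists>C\<in>cylinders. measure L ((B i - C) \<union> (C - B i)) < \<delta>"
      using Union.IH by blast
    then obtain C where C: "\<And>i. C i \<in> cylinders" "\<And>i. measure L ((B i - C i) \<union> (C i - B i)) < \<delta>"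
      by metis
    define D where "D = (\<Union>i<k. C i)"
    have D: "D \<in> cylinders" unfolding D_def using C by (intro cylinders_UN) auto
    have "measure L ((\<Union> (range B) - D) \<union> (D - \<Union> (range B)))
        \<le> measure L ((\<Union> (range B) - B' k) \<union> (\<Union>i<k. (B i - C i) \<union> (C i - B i)))"
      by (intro L.finite_measure_mono) (use B B' cyl_L[OF C(1)] in \<open>auto simp: D_def B'_def\<close>)
    also have "\<dots> \<le> measure L (\<Union> (range B) - B' k) + measure L (\<Union>i<k. (B i - C i) \<union> (C i - B i))"
      by (intro measure_Un_le) (use B B' cyl_L[OF C(1)] in auto)
    also have "measure L (\<Union>i<k. (B i - C i) \<union> (C i - B i)) \<le> (\<Sum>i<k. measure L ((B i - C i) \<union> (C i - B i)))"
      by (intro L.finite_measure_subadditive_finite) (use B cyl_L[OF C(1)] in auto)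
    also have "\<dots> \<le> (\<Sum>i<k. \<delta>)" using C(2) by (intro sum_mono less_imp_le)
    also have "\<dots> \<le> \<epsilon> / 2" using Union.prems by (simp add: \<delta>_def field_simps)
    finally show ?case using tail D by (intro bexI[of _ D]) auto
  qed
qed

fun vertex_of :: "'v source \<Rightarrow> 'v" where
  "vertex_of (Car v) = v" | "vertex_of (Walk v) = v" | "vertex_of (Tie v t) = v"

lemma vertex_of_relabel_source [simp]: "vertex_of (relabel_source \<phi> s) = \<phi> (vertex_of s)"
  by (cases s) auto

context symmetric_parking
begin

abbreviation "conf_law \<equiv> distr M conf_space conf"

lemma prob_space_conf_law: "prob_space conf_law"
  by (rule prob_space_distr[OF measurable_conf])

lemma measure_conf_law:
  "A \<in> sets conf_space \<Longrightarrow> measure conf_law A = \<P>(\<omega> in M. conf \<omega> \<in> A)"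
  by (simp add: measure_distr vimage_def Int_def conj_commute)

lemma measure_conf_law_relabel:
  assumes "\<phi> \<in> \<Gamma>" "A \<in> sets conf_space"
  shows "measure conf_law (relabel \<phi> -` A) = measure conf_law A"
  using prob_relabel[OF assms(1), of "\<lambda>y. y \<in> A"] assms(2) measurable_sets[OF measurable_relabel assms(2), of \<phi>]
  by (simp add: measure_distr vimage_def Int_def conj_commute pred_def)

text \<open>
  The cylinder depends on the sources in \<open>J\<close>, its preimage on those in the image of \<open>J\<close>.
\<close>

lemma displaced_cylinder_independent:
  assumes \<psi>: "\<psi> \<in> \<Gamma>" and X: "X \<in> sets (\<Pi>\<^sub>M s\<in>J. outcome_space)"
    and disj: "J \<inter> relabel_source \<psi> ` J = {}"
  shows "measure conf_law (cylinder J X \<inter> relabel \<psi> -` cylinder J X) = (measure conf_law (cylinder J X))\<^sup>2"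
proof -
  let ?N = "\<lambda>_. outcome_space :: 'v outcome measure" and ?J' = "relabel_source \<psi> ` J"
  define h where "h = (\<lambda>(z :: 'v conf) s. if s \<in> J then relabel_outcome \<psi> s (z (relabel_source \<psi> s)) else undefined)"
  have h: "h \<in> PiM ?J' ?N \<rightarrow>\<^sub>M PiM J ?N"
    unfolding h_def[abs_def]
  proof (rule measurable_PiM_single')
    fix s assume "s \<in> J"
    then have "(\<lambda>z. z (relabel_source \<psi> s)) \<in> PiM ?J' ?N \<rightarrow>\<^sub>M outcome_space"
      by (intro measurable_component_singleton) auto
    from measurable_compose[OF this measurable_relabel_outcome]
    show "(\<lambda>z. if s \<in> J then relabel_outcome \<psi> s (z (relabel_source \<psi> s)) else undefined) \<in> PiM ?J' ?N \<rightarrow>\<^sub>M outcome_space"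
      using \<open>s \<in> J\<close> by simp
  qed (auto simp: PiE_iff)
  have eq: "h (restrict y ?J') = restrict (relabel \<psi> y) J" for y
    by (auto simp: h_def fun_eq_iff relabel_apply)
  have Y: "h -` X \<inter> space (PiM ?J' ?N) \<in> sets (PiM ?J' ?N)"
    by (rule measurable_sets[OF h X])
  have sp: "restrict y S \<in> space (PiM S ?N)" for y S
    by (simp add: space_PiM)
  have ind: "indep_var (PiM J ?N) (\<lambda>\<omega>. restrict (\<lambda>s. conf \<omega> s) J) (PiM ?J' ?N) (\<lambda>\<omega>. restrict (\<lambda>s. conf \<omega> s) ?J')"
    by (rule indep_var_restrict[OF indep_sources]) (use disj in auto)
  have C: "cylinder J X \<in> sets conf_space" using X by (rule sets_cylinder)
  have RC: "relabel \<psi> -` cylinder J X \<in> sets conf_space"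
    using measurable_sets[OF measurable_relabel C, of \<psi>] by simp
  have "measure conf_law (cylinder J X \<inter> relabel \<psi> -` cylinder J X)
      = measure conf_law (cylinder J X) * measure conf_law (relabel \<psi> -` cylinder J X)"
    using indep_varD[OF ind X Y]
    unfolding measure_conf_law[OF C] measure_conf_law[OF RC] measure_conf_law[OF sets.Int[OF C RC]]
    by (simp add: sp eq cylinder_def vimage_def Int_def conj_commute)
  then show ?thesis
    using measure_conf_law_relabel[OF \<psi> C] by (simp add: power2_eq_square)
qed

text \<open>
  Approximate \<open>A\<close> by a cylinder \<open>C\<close> and choose a power \<open>\<psi>\<close> of \<open>\<phi>\<close> that displaces the sources of
  \<open>C\<close>. Then the probability \<open>a\<close> of \<open>A\<close>, which is that of the intersection of \<open>A\<close> with its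
  \<open>\<psi>\<close>-preimage, is close to the squared probability of \<open>C\<close>, hence to \<open>a\<^sup>2\<close>.
\<close>

theorem zero_one_law:
  assumes \<phi>: "\<phi> \<in> \<Gamma>" and inf: "infinite {(\<phi> ^^ n) u | n. True}"
    and A: "A \<in> sets conf_space"
    and invariant: "\<And>n. measure conf_law (A \<inter> relabel (\<phi> ^^ n) -` A) = measure conf_law A"
  shows "measure conf_law A = 0 \<or> measure conf_law A = 1"
proof -
  interpret L: prob_space conf_law by (rule prob_space_conf_law)
  have close: "measure conf_law S \<le> measure conf_law T + measure conf_law D"
    if "S \<subseteq> T \<union> D" "S \<in> sets conf_space" "T \<in> sets conf_space" "D \<in> sets conf_space" for S T D
  proof -
    have "measure conf_law S \<le> measure conf_law (T \<union> D)"
      using that by (intro L.finite_measure_mono) auto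
    also have "\<dots> \<le> measure conf_law T + measure conf_law D"
      using that by (intro measure_Un_le) auto
    finally show ?thesis .
  qed
  define a where "a = measure conf_law A"
  have a01: "0 \<le> a" "a \<le> 1" by (simp_all add: a_def)
  have "\<bar>a - a\<^sup>2\<bar> \<le> 0 + \<epsilon>" if \<epsilon>: "0 < \<epsilon>" for \<epsilon>
  proof -
    obtain C where C: "C \<in> cylinders" "measure conf_law ((A - C) \<union> (C - A)) < \<epsilon> / 4"
      using cylinder_approximation[OF prob_space_conf_law _ A, of "\<epsilon> / 4"] \<epsilon> by auto
    obtain J X where J: "finite J" and X: "X \<in> sets (\<Pi>\<^sub>M s\<in>J. outcome_space)" and CJ: "C = cylinder J X"
      using C by (auto simp: cylinders_def)
    obtain n where n: "(\<phi> ^^ n) ` (vertex_of ` J) \<inter> vertex_of ` J = {}"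
      using funpow_displaces_finite[OF \<phi> inf, of "vertex_of ` J"] J by auto
    define \<psi> where "\<psi> = \<phi> ^^ n"
    have \<psi>: "\<psi> \<in> \<Gamma>" using funpow_member[OF \<phi>] by (simp add: \<psi>_def)
    have "J \<inter> relabel_source \<psi> ` J = {}"
    proof (rule ccontr)
      assume "J \<inter> relabel_source \<psi> ` J \<noteq> {}"
      then obtain s where "s \<in> J" "relabel_source \<psi> s \<in> J" by blast
      then have "\<psi> (vertex_of s) \<in> (\<phi> ^^ n) ` (vertex_of ` J) \<inter> vertex_of ` J"
        using imageI[of "relabel_source \<psi> s" J vertex_of] by (simp add: \<psi>_def)
      with n show False by simp
    qed
    from displaced_cylinder_independent[OF \<psi> X this]
    have ind: "measure conf_law (C \<inter> relabel \<psi> -` C) = (measure conf_law C)\<^sup>2" by (simp add: CJ)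
    define D where "D = (A - C) \<union> (C - A)"
    define c where "c = measure conf_law C"
    define d where "d = measure conf_law D"
    have sets: "C \<in> sets conf_space" "D \<in> sets conf_space" "A \<in> sets conf_space"
      using C(1) A sets_cylinders[OF C(1)] by (auto simp: D_def)
    have rel: "relabel \<psi> -` S \<in> sets conf_space" if "S \<in> sets conf_space" for S
      using measurable_sets[OF measurable_relabel that, of \<psi>] by simp
    have "d < \<epsilon> / 4" using C(2) by (simp add: d_def D_def)
    have dT: "measure conf_law (relabel \<psi> -` D) = d"
      using measure_conf_law_relabel[OF \<psi> sets(2)] by (simp add: d_def)
    have dd: "measure conf_law (D \<union> relabel \<psi> -` D) \<le> 2 * d"
      using measure_Un_le[of D conf_law "relabel \<psi> -` D"] sets rel by (simp add: dT d_def)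
    have "a \<le> c + d" "c \<le> a + d"
      unfolding a_def c_def d_def by (intro close; use sets in \<open>auto simp: D_def\<close>)+
    moreover have "a \<le> c\<^sup>2 + 2 * d"
    proof -
      have "A \<inter> relabel \<psi> -` A \<subseteq> (C \<inter> relabel \<psi> -` C) \<union> (D \<union> relabel \<psi> -` D)"
        unfolding D_def by blast
      from close[OF this] show ?thesis
        using sets rel dd invariant[of n, folded \<psi>_def] ind unfolding a_def c_def
        by (simp add: sets.Int sets.Un)
    qed
    moreover have "c\<^sup>2 \<le> a + 2 * d"
    proof -
      have "C \<inter> relabel \<psi> -` C \<subseteq> (A \<inter> relabel \<psi> -` A) \<union> (D \<union> relabel \<psi> -` D)"
        unfolding D_def by blast
      from close[OF this] show ?thesis
        using sets rel dd invariant[of n, folded \<psi>_def] ind unfolding a_def c_def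
        by (simp add: sets.Int sets.Un)
    qed
    moreover have "0 \<le> c" "c \<le> 1" by (simp_all add: c_def)
    have "\<bar>c\<^sup>2 - a\<^sup>2\<bar> \<le> 2 * d"
    proof -
      have "c\<^sup>2 - a\<^sup>2 = (c + a) * (c - a)" by (simp add: power2_eq_square algebra_simps)
      then have "\<bar>c\<^sup>2 - a\<^sup>2\<bar> = \<bar>c + a\<bar> * \<bar>c - a\<bar>" by (simp add: abs_mult)
      also have "\<dots> \<le> 2 * d"
        using \<open>a \<le> c + d\<close> \<open>c \<le> a + d\<close> \<open>0 \<le> c\<close> \<open>c \<le> 1\<close> a01 by (intro mult_mono) auto
      finally show ?thesis .
    qed
    ultimately show ?thesis using \<open>d < \<epsilon> / 4\<close> by linarith
  qed
  then have "\<bar>a - a\<^sup>2\<bar> \<le> 0" by (rule field_le_epsilon)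
  then have "a * (1 - a) = 0" by (simp add: power2_eq_square algebra_simps)
  then show ?thesis by (auto simp: a_def)
qed

end

section \<open>Occupation counts\<close>

context symmetric_parking
begin

lemma nn_integral_vertices_swap:
  fixes f :: "'v \<Rightarrow> 'w \<Rightarrow> ennreal"
  assumes "\<And>v. f v \<in> borel_measurable M"
  shows "(\<integral>\<^sup>+ \<omega>. \<integral>\<^sup>+ v. f v \<omega> \<partial>count_space UNIV \<partial>M) = (\<integral>\<^sup>+ v. \<integral>\<^sup>+ \<omega>. f v \<omega> \<partial>M \<partial>count_space UNIV)"
  by (rule nn_integral_count_space_nn_integral[OF countable_vertices]) (rule assms)

lemma borel_measurable_vertex_sum:
  fixes f :: "'v \<Rightarrow> 'w \<Rightarrow> ennreal"
  assumes "\<And>v. f v \<in> borel_measurable M"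
  shows "(\<lambda>\<omega>. \<integral>\<^sup>+ v. f v \<omega> \<partial>count_space UNIV) \<in> borel_measurable M"
proof -
  interpret V: sigma_finite_measure "count_space (UNIV :: 'v set)"
    by (rule sigma_finite_measure_count_space_countable[OF countable_vertices])
  have "(\<lambda>z. f (snd z) (fst z)) \<in> borel_measurable (M \<Otimes>\<^sub>M count_space UNIV)"
    by (rule measurable_compose_countable'[where f = "\<lambda>v z. f v (fst z)" and g = snd and I = UNIV])
      (use countable_vertices in \<open>auto intro: measurable_compose[OF measurable_fst assms]\<close>)
  then show ?thesis
    by (intro V.borel_measurable_nn_integral) (simp add: case_prod_beta')
qed

lemma prob_countable_disjoint:
  assumes P: "\<And>v. Measurable.pred M (P v)"
    and disj: "\<And>u v \<omega>. P u \<omega> \<Longrightarrow> P v \<omega> \<Longrightarrow> u = v"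
  shows "(\<integral>\<^sup>+ (v :: 'v). ennreal \<P>(\<omega> in M. P v \<omega>) \<partial>count_space UNIV) = ennreal \<P>(\<omega> in M. \<exists>v. P v \<omega>)"
proof -
  have "{\<omega>\<in>space M. \<exists>v. P v \<omega>} = (\<Union>v\<in>UNIV. {\<omega>\<in>space M. P v \<omega>})" by auto
  then have "emeasure M {\<omega>\<in>space M. \<exists>v. P v \<omega>} = (\<integral>\<^sup>+ v. emeasure M {\<omega>\<in>space M. P v \<omega>} \<partial>count_space UNIV)"
    using P disj
    by (simp only:) (intro emeasure_UN_countable, auto simp: countable_vertices disjoint_family_on_def pred_def)
  then show ?thesis by (simp add: emeasure_eq_measure)
qed

lemma mass_transport_prob:
  assumes P: "\<And>u v. Measurable.pred conf_space (P u v)"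
    and equi: "\<And>\<phi> u v y. \<phi> \<in> \<Gamma> \<Longrightarrow> P u v (relabel \<phi> y) \<longleftrightarrow> P (\<phi> u) (\<phi> v) y"
  shows "(\<integral>\<^sup>+ v. ennreal \<P>(\<omega> in M. P r v (conf \<omega>)) \<partial>count_space UNIV)
    = (\<integral>\<^sup>+ v. ennreal \<P>(\<omega> in M. P v r (conf \<omega>)) \<partial>count_space UNIV)"
proof (rule mass_transport[OF transitive])
  fix \<phi> u v assume \<phi>: "\<phi> \<in> \<Gamma>"
  show "ennreal \<P>(\<omega> in M. P (\<phi> u) (\<phi> v) (conf \<omega>)) = ennreal \<P>(\<omega> in M. P u v (conf \<omega>))"
    using prob_relabel[OF \<phi> P[of u v]] by (simp add: equi[OF \<phi>])
qed

text \<open>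
  Let \<open>u\<close> send to \<open>v\<close> the probability that the car from \<open>u\<close> parks at \<open>v\<close>. What \<open>r\<close> sends out is
  the probability that its car parks, what it receives the probability that it is filled.
\<close>

lemma prob_parks_eq_filled:
  "\<P>(\<omega> in M. car_parks (cars (conf \<omega>)) (walks (conf \<omega>)) (ties (conf \<omega>)) r)
    = \<P>(\<omega> in M. spot_filled (cars (conf \<omega>)) (walks (conf \<omega>)) (ties (conf \<omega>)) r)"
proof -
  define P where "P = (\<lambda>u v (y :: 'v conf). \<exists>t. parked_in y t u = Some v)"
  have [measurable]: "Measurable.pred conf_space (P u v)" for u v
    unfolding P_def by measurable
  have equi: "P u v (relabel \<phi> y) \<longleftrightarrow> P (\<phi> u) (\<phi> v) y" if \<phi>: "\<phi> \<in> \<Gamma>" for \<phi> u v y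
    using parked_at_equivariant[OF bij_member[OF \<phi>], of "cars y" "walks y" "ties y"]
    by (auto simp: P_def relabel_def inv_eq_iff[OF \<phi>] inv_app[OF \<phi>])
  have Pm: "Measurable.pred M (\<lambda>\<omega>. P u v (conf \<omega>))" for u v by measurable
  have one_spot: "P u v y \<Longrightarrow> P u v' y \<Longrightarrow> v = v'" for u v v' y
    unfolding P_def by (metis linear parked_at_mono option.inject)
  have "(\<integral>\<^sup>+ v. ennreal \<P>(\<omega> in M. P r v (conf \<omega>)) \<partial>count_space UNIV) = ennreal \<P>(\<omega> in M. \<exists>v. P r v (conf \<omega>))"
    by (rule prob_countable_disjoint[OF Pm]) (rule one_spot)
  moreover have one_car: "P u v y \<Longrightarrow> P u' v y \<Longrightarrow> u = u'" for u u' v y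
    unfolding P_def by (metis parked_at_unique)
  moreover have "(\<integral>\<^sup>+ v. ennreal \<P>(\<omega> in M. P v r (conf \<omega>)) \<partial>count_space UNIV) = ennreal \<P>(\<omega> in M. \<exists>v. P v r (conf \<omega>))"
    by (rule prob_countable_disjoint[OF Pm]) (rule one_car)
  moreover have "(\<integral>\<^sup>+ v. ennreal \<P>(\<omega> in M. P r v (conf \<omega>)) \<partial>count_space UNIV)
      = (\<integral>\<^sup>+ v. ennreal \<P>(\<omega> in M. P v r (conf \<omega>)) \<partial>count_space UNIV)"
    by (rule mass_transport_prob) (measurable, rule equi)
  ultimately have "\<P>(\<omega> in M. \<exists>v. P r v (conf \<omega>)) = \<P>(\<omega> in M. \<exists>v. P v r (conf \<omega>))"
    by simp
  moreover have "(\<exists>v. P r v y) = car_parks (cars y) (walks y) (ties y) r"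
    "(\<exists>v. P v r y) = spot_filled (cars y) (walks y) (ties y) r" for y
    by (auto simp: P_def car_parks_def spot_filled_def)
  ultimately show ?thesis by (simp only:)
qed

text \<open>
  The number of walks at \<open>x\<close> at time \<open>t\<close>, including those of parked cars and of vertices without
  a car; in contrast to the unparked cars these are independent.
\<close>

definition walkers :: "nat \<Rightarrow> 'v \<Rightarrow> 'w \<Rightarrow> ennreal" where
  "walkers t x \<omega> = (\<integral>\<^sup>+ w. indicator {\<omega>. walk w t \<omega> = x} \<omega> \<partial>count_space UNIV)"

lemma measurable_walkers [measurable]: "walkers t x \<in> borel_measurable M"
  unfolding walkers_def[abs_def] by (rule borel_measurable_vertex_sum) measurable

lemma nn_integral_indicator_event:
  assumes "Measurable.pred M Q"
  shows "(\<integral>\<^sup>+ \<omega>. indicator {\<omega>. Q \<omega>} \<omega> \<partial>M) = ennreal \<P>(\<omega> in M. Q \<omega>)"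
proof -
  have "(\<integral>\<^sup>+ \<omega>. indicator {\<omega>. Q \<omega>} \<omega> \<partial>M) = (\<integral>\<^sup>+ \<omega>. indicator {\<omega>\<in>space M. Q \<omega>} \<omega> \<partial>M)"
    by (intro nn_integral_cong) (auto split: split_indicator)
  then show ?thesis using assms by (simp add: pred_def emeasure_eq_measure)
qed

text \<open>
  By mass transport the mean number of walks at \<open>x\<close> is the number of places where the walk from
  \<open>x\<close> is, namely one.
\<close>

lemma sum_prob_walk_at: "(\<integral>\<^sup>+ w. ennreal \<P>(\<omega> in M. walk w t \<omega> = x) \<partial>count_space UNIV) = 1"
proof -
  have "(\<integral>\<^sup>+ w. ennreal \<P>(\<omega> in M. walk x t \<omega> = w) \<partial>count_space UNIV) = ennreal \<P>(\<omega> in M. \<exists>w. walk x t \<omega> = w)"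
    by (rule prob_countable_disjoint) auto
  moreover have "(\<integral>\<^sup>+ w. ennreal \<P>(\<omega> in M. walks (conf \<omega>) x t = w) \<partial>count_space UNIV)
      = (\<integral>\<^sup>+ w. ennreal \<P>(\<omega> in M. walks (conf \<omega>) w t = x) \<partial>count_space UNIV)"
    by (rule mass_transport_prob) (auto simp: relabel_def inv_eq_iff)
  ultimately show ?thesis by (simp add: prob_space)
qed

lemma expectation_walkers: "(\<integral>\<^sup>+ \<omega>. walkers t x \<omega> \<partial>M) = 1"
  unfolding walkers_def
  by (subst nn_integral_vertices_swap) (simp_all add: nn_integral_indicator_event sum_prob_walk_at)

lemma AE_finite_walkers: "AE \<omega> in M. finite {w. walk w t \<omega> = x}"
proof -
  have "AE \<omega> in M. walkers t x \<omega> \<noteq> \<infinity>"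
    by (rule nn_integral_PInf_AE) (simp_all add: expectation_walkers)
  moreover have "walkers t x \<omega> = emeasure (count_space UNIV) {w. walk w t \<omega> = x}" for \<omega>
  proof -
    have "walkers t x \<omega> = (\<integral>\<^sup>+ w. indicator {w. walk w t \<omega> = x} w \<partial>count_space UNIV)"
      unfolding walkers_def by (intro nn_integral_cong) (auto split: split_indicator)
    then show ?thesis by simp
  qed
  ultimately show ?thesis by (auto simp: emeasure_count_space split: if_splits)
qed

lemma indep_two_sources:
  assumes s: "s \<noteq> s'" and g: "g \<in> outcome_space \<rightarrow>\<^sub>M N" and h: "h \<in> outcome_space \<rightarrow>\<^sub>M N'"
  shows "indep_var N (\<lambda>\<omega>. g (conf \<omega> s)) N' (\<lambda>\<omega>. h (conf \<omega> s'))"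
proof -
  let ?N = "\<lambda>_. outcome_space :: 'v outcome measure"
  have "indep_var (PiM {s} ?N) (\<lambda>\<omega>. restrict (\<lambda>s. conf \<omega> s) {s}) (PiM {s'} ?N) (\<lambda>\<omega>. restrict (\<lambda>s. conf \<omega> s) {s'})"
    by (rule indep_var_restrict[OF indep_sources]) (use s in auto)
  moreover have "(\<lambda>z. g (z s)) \<in> PiM {s} ?N \<rightarrow>\<^sub>M N"
    by (rule measurable_compose[OF _ g]) (rule measurable_component_singleton, simp)
  moreover have "(\<lambda>z. h (z s')) \<in> PiM {s'} ?N \<rightarrow>\<^sub>M N'"
    by (rule measurable_compose[OF _ h]) (rule measurable_component_singleton, simp)
  ultimately have "indep_var N ((\<lambda>z. g (z s)) \<circ> (\<lambda>\<omega>. restrict (\<lambda>s. conf \<omega> s) {s}))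
      N' ((\<lambda>z. h (z s')) \<circ> (\<lambda>\<omega>. restrict (\<lambda>s. conf \<omega> s) {s'}))"
    by (rule indep_var_compose)
  then show ?thesis by (simp add: comp_def)
qed

lemma indep_walks_at:
  assumes "u \<noteq> v"
  shows "\<P>(\<omega> in M. walk u t \<omega> = x \<and> walk v t \<omega> = x) = \<P>(\<omega> in M. walk u t \<omega> = x) * \<P>(\<omega> in M. walk v t \<omega> = x)"
proof -
  have m: "(\<lambda>z. fst (snd z) t) \<in> outcome_space \<rightarrow>\<^sub>M count_space UNIV"
    by (rule measurable_compose[OF _ measurable_traj_at]) (unfold outcome_space_def, measurable)
  have "indep_var (count_space UNIV) (\<lambda>\<omega>. fst (snd (conf \<omega> (Walk u))) t) (count_space UNIV) (\<lambda>\<omega>. fst (snd (conf \<omega> (Walk v))) t)"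
    using assms by (intro indep_two_sources[OF _ m m]) auto
  then have "indep_var (count_space UNIV) (walk u t) (count_space UNIV) (walk v t)"
    by (simp add: conf_def)
  from indep_varD[OF this, of "{x}" "{x}"]
  show ?thesis by (simp add: vimage_def Int_def conj_commute conj_left_commute)
qed

text \<open>
  By independence the pairs of different walks contribute at most the squared mean; the diagonal
  contributes the mean.
\<close>

lemma second_moment_walkers: "(\<integral>\<^sup>+ \<omega>. walkers t x \<omega> * walkers t x \<omega> \<partial>M) \<le> 2"
proof -
  let ?i = "\<lambda>w \<omega>. indicator {\<omega>. walk w t \<omega> = x} \<omega> :: ennreal"
  let ?a = "\<lambda>w. ennreal \<P>(\<omega> in M. walk w t \<omega> = x)"
  have [measurable]: "?i w \<in> borel_measurable M" for w by measurable
  have "(\<integral>\<^sup>+ \<omega>. walkers t x \<omega> * walkers t x \<omega> \<partial>M)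
      = (\<integral>\<^sup>+ \<omega>. \<integral>\<^sup>+ u. ?i u \<omega> * walkers t x \<omega> \<partial>count_space UNIV \<partial>M)"
    by (simp add: nn_integral_multc walkers_def)
  also have "\<dots> = (\<integral>\<^sup>+ u. \<integral>\<^sup>+ \<omega>. ?i u \<omega> * walkers t x \<omega> \<partial>M \<partial>count_space UNIV)"
    by (rule nn_integral_vertices_swap) measurable
  also have "\<dots> = (\<integral>\<^sup>+ u. \<integral>\<^sup>+ \<omega>. \<integral>\<^sup>+ v. ?i u \<omega> * ?i v \<omega> \<partial>count_space UNIV \<partial>M \<partial>count_space UNIV)"
    by (simp add: nn_integral_cmult walkers_def)
  also have "\<dots> = (\<integral>\<^sup>+ u. \<integral>\<^sup>+ v. \<integral>\<^sup>+ \<omega>. ?i u \<omega> * ?i v \<omega> \<partial>M \<partial>count_space UNIV \<partial>count_space UNIV)"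
    by (intro nn_integral_cong nn_integral_vertices_swap) measurable
  also have "\<dots> \<le> (\<integral>\<^sup>+ u. \<integral>\<^sup>+ v. ?a u * ?a v + ?a u * indicator {u} v \<partial>count_space UNIV \<partial>count_space UNIV)"
  proof (intro nn_integral_mono)
    fix u v
    have "(\<integral>\<^sup>+ \<omega>. ?i u \<omega> * ?i v \<omega> \<partial>M) = (\<integral>\<^sup>+ \<omega>. indicator {\<omega>. walk u t \<omega> = x \<and> walk v t \<omega> = x} \<omega> \<partial>M)"
      by (intro nn_integral_cong) (auto split: split_indicator)
    also have "\<dots> = ennreal \<P>(\<omega> in M. walk u t \<omega> = x \<and> walk v t \<omega> = x)"
      by (rule nn_integral_indicator_event) measurable
    also have "\<dots> \<le> ?a u * ?a v + ?a u * indicator {u} v"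
      by (cases "u = v") (auto simp: indep_walks_at ennreal_mult)
    finally show "(\<integral>\<^sup>+ \<omega>. ?i u \<omega> * ?i v \<omega> \<partial>M) \<le> ?a u * ?a v + ?a u * indicator {u} v" .
  qed
  also have "\<dots> = (\<integral>\<^sup>+ u. ?a u + ?a u \<partial>count_space UNIV)"
    by (intro nn_integral_cong) (simp add: nn_integral_add nn_integral_cmult sum_prob_walk_at)
  also have "\<dots> = 2"
    by (simp add: nn_integral_add sum_prob_walk_at one_add_one)
  finally show ?thesis .
qed

lemma sum_prob_unparked_at:
  "(\<integral>\<^sup>+ w. ennreal \<P>(\<omega> in M. unparked_in (conf \<omega>) t w \<and> walk w t \<omega> = x) \<partial>count_space UNIV)
    = ennreal \<P>(\<omega> in M. unparked_in (conf \<omega>) t x)"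
proof -
  have "(\<integral>\<^sup>+ w. ennreal \<P>(\<omega> in M. unparked_in (conf \<omega>) t x \<and> walks (conf \<omega>) x t = w) \<partial>count_space UNIV)
      = (\<integral>\<^sup>+ w. ennreal \<P>(\<omega> in M. unparked_in (conf \<omega>) t w \<and> walks (conf \<omega>) w t = x) \<partial>count_space UNIV)"
  proof (rule mass_transport_prob)
    show "Measurable.pred conf_space (\<lambda>y. unparked_in y t u \<and> walks y u t = v)" for u v :: 'v
      by measurable
    fix \<phi> and u v :: 'v and y assume \<phi>: "\<phi> \<in> \<Gamma>"
    show "(unparked_in (relabel \<phi> y) t u \<and> walks (relabel \<phi> y) u t = v) =
        (unparked_in y t (\<phi> u) \<and> walks y (\<phi> u) t = \<phi> v)"
      using unparked_in_relabel[OF bij_member[OF \<phi>]] by (simp add: inv_eq_iff[OF \<phi>] relabel_def)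
  qed
  moreover have "(\<integral>\<^sup>+ w. ennreal \<P>(\<omega> in M. unparked_in (conf \<omega>) t x \<and> walk x t \<omega> = w) \<partial>count_space UNIV)
      = ennreal \<P>(\<omega> in M. \<exists>w. unparked_in (conf \<omega>) t x \<and> walk x t \<omega> = w)"
  proof (rule prob_countable_disjoint)
    show "Measurable.pred M (\<lambda>\<omega>. unparked_in (conf \<omega>) t x \<and> walk x t \<omega> = w)" for w
      by measurable
  qed auto
  ultimately show ?thesis by simp
qed

text \<open>
  By mass transport the left-hand side is the mean of the number \<open>V\<close> of unparked cars at \<open>x\<close>. If \<open>W\<close>
  is the number of walks at \<open>x\<close>, then \<open>V \<le> W\<close>, and either \<open>W \<le> c\<close> or \<open>W \<le> W\<^sup>2 / c\<close>. So \<open>V\<close> is at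
  most \<open>c\<close> times the indicator of \<open>V \<noteq> 0\<close> plus \<open>W\<^sup>2 / c\<close>, and it remains to take means.
\<close>

lemma prob_unparked_le_occupied:
  assumes c: "0 < c"
  shows "\<P>(\<omega> in M. unparked_in (conf \<omega>) t x) \<le> c * \<P>(\<omega> in M. occupied_in (conf \<omega>) t x) + 2 / c"
proof -
  let ?V = "\<lambda>\<omega>. \<integral>\<^sup>+ w. indicator {\<omega>. unparked_in (conf \<omega>) t w \<and> walk w t \<omega> = x} \<omega> \<partial>count_space UNIV"
  let ?O = "\<lambda>\<omega>. indicator {\<omega>. occupied_in (conf \<omega>) t x} \<omega> :: ennreal"
  have O[measurable]: "?O \<in> borel_measurable M" by measurable
  have V: "?V \<omega> \<le> ennreal c * ?O \<omega> + ennreal (1 / c) * (walkers t x \<omega> * walkers t x \<omega>)" for \<omega>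
  proof (cases "occupied_in (conf \<omega>) t x")
    case False
    then have "?V \<omega> = 0" by (auto simp: occupied_def nn_integral_0_iff_AE)
    then show ?thesis by simp
  next
    case True
    have le: "?V \<omega> \<le> walkers t x \<omega>"
      unfolding walkers_def by (intro nn_integral_mono) (auto split: split_indicator)
    show ?thesis
    proof (cases "walkers t x \<omega> \<le> ennreal c")
      case True
      with le have "?V \<omega> \<le> ennreal c * ?O \<omega>"
        using \<open>occupied_in (conf \<omega>) t x\<close> by (simp del: conf_simps)
      then show ?thesis by (rule add_increasing2[OF zero_le])
    next
      case False
      have "?V \<omega> \<le> ennreal (1 / c) * (ennreal c * walkers t x \<omega>)"
        using le c by (simp add: mult.assoc[symmetric] flip: ennreal_mult)
      also have "\<dots> \<le> ennreal (1 / c) * (walkers t x \<omega> * walkers t x \<omega>)"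
        using False by (intro mult_left_mono mult_right_mono) auto
      finally show ?thesis by (intro add_increasing) auto
    qed
  qed
  have "ennreal \<P>(\<omega> in M. unparked_in (conf \<omega>) t x) = (\<integral>\<^sup>+ \<omega>. ?V \<omega> \<partial>M)"
    by (subst nn_integral_vertices_swap) (simp_all add: nn_integral_indicator_event flip: sum_prob_unparked_at)
  also have "\<dots> \<le> (\<integral>\<^sup>+ \<omega>. ennreal c * ?O \<omega> + ennreal (1 / c) * (walkers t x \<omega> * walkers t x \<omega>) \<partial>M)"
    by (intro nn_integral_mono V)
  also have "\<dots> = ennreal c * (\<integral>\<^sup>+ \<omega>. ?O \<omega> \<partial>M) + ennreal (1 / c) * (\<integral>\<^sup>+ \<omega>. walkers t x \<omega> * walkers t x \<omega> \<partial>M)"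
    by (simp add: nn_integral_add nn_integral_cmult)
  also have "\<dots> \<le> ennreal c * ennreal \<P>(\<omega> in M. occupied_in (conf \<omega>) t x) + ennreal (1 / c) * 2"
    using second_moment_walkers[of t x]
    by (subst nn_integral_indicator_event) (auto intro!: add_mono mult_left_mono)
  also have "\<dots> = ennreal (c * \<P>(\<omega> in M. occupied_in (conf \<omega>) t x) + 2 / c)"
    using c by (simp add: ennreal_mult[symmetric] ennreal_plus[symmetric] ennreal_numeral[symmetric] del: ennreal_plus ennreal_numeral)
  finally show ?thesis
    using c by (subst (asm) ennreal_le_iff) auto
qed

lemma visited_io_positive:
  assumes \<epsilon>: "0 < \<epsilon>" and unparked: "\<And>t. \<epsilon> \<le> \<P>(\<omega> in M. unparked_in (conf \<omega>) t x)"
  shows "0 < \<P>(\<omega> in M. visited_io_in (conf \<omega>) x)"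
proof -
  \<comment> \<open>With this choice the second-moment term \<open>2 / c\<close> is half of \<open>\<epsilon>\<close>.\<close>
  define c where "c = 4 / \<epsilon>"
  have c: "0 < c" using \<epsilon> by (simp add: c_def)
  define \<delta> where "\<delta> = \<epsilon> / (2 * c)"
  have \<delta>: "0 < \<delta>" using \<epsilon> c by (simp add: \<delta>_def)
  have occ: "\<delta> \<le> \<P>(\<omega> in M. occupied_in (conf \<omega>) t x)" for t
  proof -
    have "2 / c = \<epsilon> / 2" by (simp add: c_def)
    then have "\<epsilon> / 2 \<le> c * \<P>(\<omega> in M. occupied_in (conf \<omega>) t x)"
      using prob_unparked_le_occupied[OF c, of t x] unparked[of t] by linarith
    then show ?thesis using c by (simp add: \<delta>_def field_simps)
  qed
  define A where "A = (\<lambda>n. {\<omega>\<in>space M. \<exists>t\<ge>n. occupied_in (conf \<omega>) t x})"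
  have A: "A n \<in> events" for n unfolding A_def by measurable
  have "\<delta> \<le> prob (A n)" for n
    by (rule order_trans[OF occ[of n]], rule finite_measure_mono) (use A in \<open>auto simp: A_def\<close>)
  moreover have "(\<lambda>n. prob (A n)) \<longlonglongrightarrow> prob (\<Inter>n. A n)"
    by (rule finite_Lim_measure_decseq) (use A in \<open>auto simp: decseq_def A_def\<close>, meson order_trans)
  ultimately have "\<delta> \<le> prob (\<Inter>n. A n)"
    by (intro LIMSEQ_le_const) auto
  moreover have "(\<Inter>n. A n) = {\<omega>\<in>space M. visited_io_in (conf \<omega>) x}"
    by (auto simp: A_def visited_io_def)
  ultimately show ?thesis using \<delta> by simp
qed

end

section \<open>Either every car parks or every spot is filled\<close>

context symmetric_parking
begin

lemma AE_relabel:
  assumes \<phi>: "\<phi> \<in> \<Gamma>" and Q[measurable]: "Measurable.pred conf_space Q" and AE: "AE \<omega> in M. Q (conf \<omega>)"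
  shows "AE \<omega> in M. Q (relabel \<phi> (conf \<omega>))"
proof -
  have "\<P>(\<omega> in M. Q (conf \<omega>)) = 1"
    using AE by (subst prob_Collect_eq_1) measurable
  then have "\<P>(\<omega> in M. Q (relabel \<phi> (conf \<omega>))) = 1"
    using prob_relabel[OF \<phi> Q] by simp
  then show ?thesis
    by (subst (asm) prob_Collect_eq_1) measurable
qed

text \<open>
  The diagonal is a null set for a product of atomless measures.
\<close>

lemma AE_ties_distinct_pair:
  assumes "v \<noteq> w"
  shows "AE \<omega> in M. tie v t \<omega> \<noteq> tie w t \<omega>"
proof -
  let ?L = "uniform_measure lborel {0..1} :: real measure"
  have m: "(\<lambda>z. snd (snd z)) \<in> outcome_space \<rightarrow>\<^sub>M (borel :: real measure)"
    unfolding outcome_space_def by measurable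
  have "indep_var borel (\<lambda>\<omega>. snd (snd (conf \<omega> (Tie v t)))) borel (\<lambda>\<omega>. snd (snd (conf \<omega> (Tie w t))))"
    using assms by (intro indep_two_sources[OF _ m m]) auto
  then have "indep_var borel (tie v t) borel (tie w t)"
    by (simp add: conf_def)
  then have joint: "?L \<Otimes>\<^sub>M ?L = distr M (borel \<Otimes>\<^sub>M borel) (\<lambda>\<omega>. (tie v t \<omega>, tie w t \<omega>))"
    unfolding indep_var_distribution_eq by (simp add: tie_law)
  interpret L: prob_space ?L
    by (rule prob_space_uniform_measure) auto
  have D: "{z \<in> space (borel \<Otimes>\<^sub>M borel). fst z = snd z} \<in> sets (borel \<Otimes>\<^sub>M (borel :: real measure))"
    by measurable
  then have D': "{z \<in> space (borel \<Otimes>\<^sub>M borel). fst z = snd z} \<in> sets (?L \<Otimes>\<^sub>M ?L)"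
    by (simp cong: sets_pair_measure_cong)
  have point: "emeasure ?L (Pair x -` {z \<in> space (borel \<Otimes>\<^sub>M borel). fst z = snd z}) = 0" for x
  proof -
    have "Pair x -` {z \<in> space (borel \<Otimes>\<^sub>M borel). fst z = snd z} = {x}"
      by (auto simp: space_pair_measure)
    moreover have "emeasure lborel ({0..1} \<inter> {x}) \<le> emeasure lborel {x}"
      by (intro emeasure_mono) auto
    then have "emeasure lborel ({0..1} \<inter> {x}) = 0" by simp
    ultimately show ?thesis by simp
  qed
  have "emeasure (?L \<Otimes>\<^sub>M ?L) {z \<in> space (borel \<Otimes>\<^sub>M borel). fst z = snd z} = 0"
    by (subst L.emeasure_pair_measure_alt[OF D']) (simp only: point, simp)
  then have "emeasure M {\<omega>\<in>space M. tie v t \<omega> = tie w t \<omega>} = 0"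
    unfolding joint using D by (subst (asm) emeasure_distr) (auto simp: vimage_def Int_def conj_commute space_pair_measure)
  then show ?thesis
    by (intro AE_I[where N = "{\<omega>\<in>space M. tie v t \<omega> = tie w t \<omega>}"]) auto
qed

lemma AE_ties_distinct: "AE \<omega> in M. \<forall>v w. v \<noteq> w \<longrightarrow> tie v t \<omega> \<noteq> tie w t \<omega>"
proof -
  have "AE \<omega> in M. \<forall>v\<in>UNIV. \<forall>w\<in>UNIV. v \<noteq> w \<longrightarrow> tie v t \<omega> \<noteq> tie w t \<omega>"
    unfolding AE_ball_countable[OF countable_vertices]
    using AE_ties_distinct_pair[of _ _ t] by (auto intro: AE_impI)
  then show ?thesis by simp
qed

lemma AE_visited_spot_filled:
  "AE \<omega> in M. visited_io_in (conf \<omega>) x \<longrightarrow> \<not> car x \<omega> \<longrightarrow>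
    spot_filled (cars (conf \<omega>)) (walks (conf \<omega>)) (ties (conf \<omega>)) x"
proof -
  have "AE \<omega> in M. \<forall>t. finite {w. walk w t \<omega> = x}" "AE \<omega> in M. \<forall>t. \<forall>v w. v \<noteq> w \<longrightarrow> tie v t \<omega> \<noteq> tie w t \<omega>"
    unfolding AE_all_countable using AE_finite_walkers AE_ties_distinct by blast+
  then show ?thesis
  proof eventually_elim
    case (elim \<omega>)
    show ?case
    proof (intro impI)
      assume io: "visited_io_in (conf \<omega>) x" and spot: "\<not> car x \<omega>"
      obtain t where "t \<ge> 1" "occupied_in (conf \<omega>) t x"
        using io unfolding visited_io_def by blast
      then obtain s where "occupied_in (conf \<omega>) (Suc s) x"
        by (metis One_nat_def Suc_le_D)
      then show "spot_filled (cars (conf \<omega>)) (walks (conf \<omega>)) (ties (conf \<omega>)) x"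
        by (rule spot_filled_if_occupied[rotated]) (use spot elim in \<open>simp_all add: conf_def\<close>)
    qed
  qed
qed

text \<open>
  Infinitely many visits to \<open>(\<phi> ^^ n) u\<close> almost surely entail infinitely many visits to \<open>u\<close>, since
  \<open>u\<close> is accessible from \<open>\<phi> u\<close> and relabelling by powers of \<open>\<phi>\<close> preserves the law. Both events
  have the same probability, so the intersection has it as well, which is the invariance needed for
  \<open>zero_one_law\<close>.
\<close>

lemma visited_io_zero_one:
  assumes \<phi>: "\<phi> \<in> \<Gamma>" and inf: "infinite {(\<phi> ^^ n) u | n. True}" and acc: "accessible_from E K u (\<phi> u)"
  shows "\<P>(\<omega> in M. visited_io_in (conf \<omega>) r) = 0 \<or> \<P>(\<omega> in M. visited_io_in (conf \<omega>) r) = 1"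
proof -
  let ?I = "\<lambda>x y. visited_io_in y x"
  have shift: "\<P>(\<omega> in M. ?I (\<psi> x) (conf \<omega>)) = \<P>(\<omega> in M. ?I x (conf \<omega>))" if \<psi>: "\<psi> \<in> \<Gamma>" for \<psi> x
    using prob_relabel[OF \<psi>, of "?I x"] by (simp only: visited_io_in_relabel[OF bij_member[OF \<psi>]]) measurable
  have AE1: "AE \<omega> in M. ?I ((\<phi> ^^ n) (\<phi> u)) (conf \<omega>) \<longrightarrow> ?I ((\<phi> ^^ n) u) (conf \<omega>)" for n
  proof -
    have \<psi>: "\<phi> ^^ n \<in> \<Gamma>" using \<phi> by (rule funpow_member)
    have "AE \<omega> in M. ?I (\<phi> u) (relabel (\<phi> ^^ n) (conf \<omega>)) \<longrightarrow> ?I u (relabel (\<phi> ^^ n) (conf \<omega>))"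
      by (rule AE_relabel[OF \<psi>, where Q = "\<lambda>y. ?I (\<phi> u) y \<longrightarrow> ?I u y"])
        (measurable, rule AE_visited_io_accessible[OF acc])
    then show ?thesis by (simp only: visited_io_in_relabel[OF bij_member[OF \<psi>]])
  qed
  have AEn: "AE \<omega> in M. ?I ((\<phi> ^^ n) u) (conf \<omega>) \<longrightarrow> ?I u (conf \<omega>)" for n
  proof (induction n)
    case (Suc n)
    have eq: "(\<phi> ^^ Suc n) u = (\<phi> ^^ n) (\<phi> u)" by (simp add: funpow_swap1)
    from AE1[of n] Suc show ?case unfolding eq by eventually_elim blast
  qed simp
  define A where "A = {y. ?I u y}"
  have A: "A \<in> sets conf_space"
    using pred_visited_io_in[OF countable_vertices, of u] by (simp add: A_def pred_def)
  have mA: "measure conf_law A = \<P>(\<omega> in M. ?I u (conf \<omega>))"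
    unfolding measure_conf_law[OF A] by (simp add: A_def)
  have "measure conf_law (A \<inter> relabel (\<phi> ^^ n) -` A) = measure conf_law A" for n
  proof -
    have \<psi>: "\<phi> ^^ n \<in> \<Gamma>" using \<phi> by (rule funpow_member)
    have T: "relabel (\<phi> ^^ n) -` A = {y. ?I ((\<phi> ^^ n) u) y}"
      unfolding A_def vimage_def by (simp only: mem_Collect_eq visited_io_in_relabel[OF bij_member[OF \<psi>]])
    have "A \<inter> {y. ?I ((\<phi> ^^ n) u) y} \<in> sets conf_space"
      using sets.Int[OF A] pred_visited_io_in[OF countable_vertices, of "(\<phi> ^^ n) u"] by (simp add: pred_def)
    from measure_conf_law[OF this]
    have "measure conf_law (A \<inter> relabel (\<phi> ^^ n) -` A) = \<P>(\<omega> in M. ?I u (conf \<omega>) \<and> ?I ((\<phi> ^^ n) u) (conf \<omega>))"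
      unfolding T by (simp only: A_def Int_iff mem_Collect_eq)
    also have "\<dots> = \<P>(\<omega> in M. ?I ((\<phi> ^^ n) u) (conf \<omega>))"
    proof (rule prob_eq_AE)
      show "AE \<omega> in M. (?I u (conf \<omega>) \<and> ?I ((\<phi> ^^ n) u) (conf \<omega>)) = ?I ((\<phi> ^^ n) u) (conf \<omega>)"
        using AEn[of n] by eventually_elim blast
    qed measurable
    also have "\<dots> = measure conf_law A" unfolding mA by (rule shift[OF \<psi>])
    finally show ?thesis .
  qed
  from zero_one_law[OF \<phi> inf A this]
  have "\<P>(\<omega> in M. ?I u (conf \<omega>)) = 0 \<or> \<P>(\<omega> in M. ?I u (conf \<omega>)) = 1" by (simp only: mA)
  moreover obtain \<psi> where "\<psi> \<in> \<Gamma>" "\<psi> u = r"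
    using transitive by (auto simp: transitive_triple_def transporter_def)
  ultimately show ?thesis using shift[of \<psi> u] by simp
qed

text \<open>
  Both \<open>p\<close> and \<open>1 - p\<close> are upper bounds. If the probability is less than \<open>p\<close>, then the car at \<open>r\<close>
  stays unparked with positive probability, so \<open>r\<close> is visited infinitely often almost surely and,
  if it is a spot, is filled.
\<close>

theorem prob_car_parks:
  assumes acc: "infinitely_accessible E K \<Gamma>"
  shows "\<P>(\<omega> in M. car_parks (cars (conf \<omega>)) (walks (conf \<omega>)) (ties (conf \<omega>)) r) = min p (1 - p)"
proof -
  let ?C = "\<lambda>\<omega>. car_parks (cars (conf \<omega>)) (walks (conf \<omega>)) (ties (conf \<omega>)) r"
  let ?S = "\<lambda>\<omega>. spot_filled (cars (conf \<omega>)) (walks (conf \<omega>)) (ties (conf \<omega>)) r"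
  define q where "q = \<P>(\<omega> in M. ?C \<omega>)"
  have qS: "q = \<P>(\<omega> in M. ?S \<omega>)" unfolding q_def by (rule prob_parks_eq_filled)
  have mC: "Measurable.pred M ?C" and mS: "Measurable.pred M ?S" by measurable
  have C: "car r \<omega>" if "?C \<omega>" for \<omega>
    using that parked_at_car_spot[of "cars (conf \<omega>)" "walks (conf \<omega>)" "ties (conf \<omega>)" _ r]
    by (fastforce simp: car_parks_def conf_def)
  have S: "\<not> car r \<omega>" if "?S \<omega>" for \<omega>
    using that parked_at_car_spot[of "cars (conf \<omega>)" "walks (conf \<omega>)" "ties (conf \<omega>)" _ _ r]
    by (fastforce simp: spot_filled_def conf_def)
  have np: "\<P>(\<omega> in M. \<not> car r \<omega>) = 1 - p"
    using prob_neg[of "car r"] car_law[of r] by simp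
  have "q \<le> \<P>(\<omega> in M. car r \<omega>)"
    unfolding q_def by (intro finite_measure_mono) (use C in auto)
  then have qp: "q \<le> p" by (simp add: car_law)
  have "q \<le> \<P>(\<omega> in M. \<not> car r \<omega>)"
    unfolding qS by (intro finite_measure_mono) (use S in auto)
  then have qnp: "q \<le> 1 - p" by (simp add: np)
  have "q = 1 - p" if "q \<noteq> p"
  proof -
    have "0 < p - q" using qp that by simp
    moreover have "p - q \<le> \<P>(\<omega> in M. unparked_in (conf \<omega>) t r)" for t
    proof -
      have "p = \<P>(\<omega> in M. car r \<omega>)" by (simp add: car_law)
      also have "\<dots> \<le> prob ({\<omega>\<in>space M. unparked_in (conf \<omega>) t r} \<union> {\<omega>\<in>space M. ?C \<omega>})"
      proof (intro finite_measure_mono subsetI)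
        fix \<omega> assume \<omega>: "\<omega> \<in> {\<omega> \<in> space M. car r \<omega>}"
        show "\<omega> \<in> {\<omega>\<in>space M. unparked_in (conf \<omega>) t r} \<union> {\<omega>\<in>space M. ?C \<omega>}"
          using \<omega> by (cases "parked_in (conf \<omega>) t r") (auto simp: unparked_def car_parks_def conf_def)
      next
        show "{\<omega>\<in>space M. unparked_in (conf \<omega>) t r} \<union> {\<omega>\<in>space M. ?C \<omega>} \<in> events" by measurable
      qed
      also have "\<dots> \<le> \<P>(\<omega> in M. unparked_in (conf \<omega>) t r) + q"
        unfolding q_def by (intro measure_Un_le) measurable
      finally show ?thesis by simp
    qed
    ultimately have "0 < \<P>(\<omega> in M. visited_io_in (conf \<omega>) r)"
      by (rule visited_io_positive)
    moreover obtain \<phi> u where "\<phi> \<in> \<Gamma>" "infinite {(\<phi> ^^ n) u | n. True}" "accessible_from E K u (\<phi> u)"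
      using acc by (auto simp: infinitely_accessible_def)
    ultimately have "\<P>(\<omega> in M. visited_io_in (conf \<omega>) r) = 1"
      using visited_io_zero_one[of \<phi> u E r] by auto
    then have "AE \<omega> in M. visited_io_in (conf \<omega>) r"
      by (subst (asm) prob_Collect_eq_1) measurable
    with AE_visited_spot_filled[of r] have "AE \<omega> in M. ?S \<omega> \<longleftrightarrow> \<not> car r \<omega>"
      by eventually_elim (use S in blast)
    then have "q = \<P>(\<omega> in M. \<not> car r \<omega>)"
      unfolding qS by (rule prob_eq_AE) (use mS in measurable)
    then show ?thesis by (simp add: np)
  qed
  then show ?thesis using qp qnp unfolding q_def[symmetric] by linarith
qed

end

theorem theorem2p2:
  fixes E :: "'v \<Rightarrow> 'v \<Rightarrow> bool"
    and K :: "'v \<Rightarrow> 'v \<Rightarrow> real"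
    and \<Gamma> :: "('v \<Rightarrow> 'v) set"
    and o\<^sub>0 :: 'v
    and p :: real
    and M :: "'w measure"
    and car :: "'v \<Rightarrow> 'w \<Rightarrow> bool"
    and walk :: "'v \<Rightarrow> nat \<Rightarrow> 'w \<Rightarrow> 'v"
    and tie :: "'v \<Rightarrow> nat \<Rightarrow> 'w \<Rightarrow> real"
  assumes "simple_graph E" and "locally_finite_graph E" and "connected_graph E"
    and "markov_kernel E K"
    and "subgroup \<Gamma> (Aut_K E K)"
    and "transitive_triple \<Gamma>" and "unimodular_triple \<Gamma>" and "infinitely_accessible E K \<Gamma>"
    and "0 \<le> p" and "p \<le> 1"
    and "parking_process M K p car walk tie"
  shows
    "(p > 0 \<longrightarrow>
        \<P>(\<omega> in M. car_parks (\<lambda>v. car v \<omega>) (\<lambda>v t. walk v t \<omega>) (\<lambda>v t. tie v t \<omega>) o\<^sub>0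
                 \<bar> car o\<^sub>0 \<omega>)
          = (if p > 1/2 then (1 - p) / p else 1)) \<and>
     (p < 1 \<longrightarrow>
        \<P>(\<omega> in M. spot_filled (\<lambda>v. car v \<omega>) (\<lambda>v t. walk v t \<omega>) (\<lambda>v t. tie v t \<omega>) o\<^sub>0
                 \<bar> \<not> car o\<^sub>0 \<omega>)
          = (if p \<ge> 1/2 then 1 else p / (1 - p)))"
proof -
  interpret parking_process M K p car walk tie by fact
  interpret vertex_group \<Gamma>
    using \<open>subgroup \<Gamma> (Aut_K E K)\<close> \<open>unimodular_triple \<Gamma>\<close> by (rule vertex_groupI)
  interpret symmetric_parking M K p car walk tie \<Gamma>
  proof
    show "countable (UNIV :: 'v set)"
      using \<open>locally_finite_graph E\<close> \<open>connected_graph E\<close> by (rule connected_locally_finite_countable)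
    show "K (\<phi> u) (\<phi> v) = K u v" if "\<phi> \<in> \<Gamma>" for \<phi> u v
      using \<open>subgroup \<Gamma> (Aut_K E K)\<close> that by (rule Aut_K_kernel_eq)
    show "0 \<le> K u v" for u v
      using \<open>markov_kernel E K\<close> by (simp add: markov_kernel_def)
  qed fact
  let ?C = "\<lambda>\<omega>. car_parks (\<lambda>v. car v \<omega>) (\<lambda>v t. walk v t \<omega>) (\<lambda>v t. tie v t \<omega>) o\<^sub>0"
  let ?S = "\<lambda>\<omega>. spot_filled (\<lambda>v. car v \<omega>) (\<lambda>v t. walk v t \<omega>) (\<lambda>v t. tie v t \<omega>) o\<^sub>0"
  have pC: "\<P>(\<omega> in M. ?C \<omega>) = min p (1 - p)"
    using prob_car_parks[OF \<open>infinitely_accessible E K \<Gamma>\<close>, of o\<^sub>0] by (simp add: conf_def)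
  have pS: "\<P>(\<omega> in M. ?S \<omega>) = min p (1 - p)"
    using prob_parks_eq_filled[of o\<^sub>0] pC by (simp add: conf_def)
  have C: "(?C \<omega> \<and> car o\<^sub>0 \<omega>) = ?C \<omega>" and S: "(?S \<omega> \<and> \<not> car o\<^sub>0 \<omega>) = ?S \<omega>" for \<omega>
    unfolding car_parks_def spot_filled_def by (blast dest: parked_at_car_spot)+
  have np: "\<P>(\<omega> in M. \<not> car o\<^sub>0 \<omega>) = 1 - p"
    using prob_neg[of "car o\<^sub>0"] car_law[of o\<^sub>0] by simp
  show ?thesis
    unfolding cond_prob_def C S pC pS car_law np
    by (auto simp: min_def field_simps)
qed

end
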